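(* Let $n\ge 2$, let $z=(z_1,\dots,z_n)^T\in\mathbb{R}^n$ represent the positions of the agents, and let $d^*_{ji}$ ($i,j\in\{1,\dots,n\}$) be a feasible displacement requirement, realized by $z^*=(z_1^*,\dots,z_n^* )^T$, i.e. $z_j^*-z_i^*=d_{ji}^*$ for all $i,j$. Let $\Omega$ be a predefined-time consensus function with associated $d\ge1$, $\beta(\cdot)$, $\hat\Omega(\cdot)$, and let $T_c>0$. (i) Let $\mathcal{X}_{\sigma(t)}=\langle\mathcal{F},\sigma\rangle$ be a switched dynamic network on $n$ vertices formed by connected graphs, let $\lambda=\min_{\mathcal{X}_l\in\mathcal{F}}\lambda_2(\mathcal{Q}(\mathcal{X}_l))$, $\underline m=\min_{\mathcal{X}_l\in\mathcal{F}}|\mathcal{E}(\mathcal{X}_l)|$, $\overline m=\max_{\mathcal{X}_l\in\mathcal{F}}|\mathcal{E}(\mathcal{X}_l)|$, and let $\kappa\ge\dfrac{\beta(\underline m)^d}{\lambda\beta(\overline m)^2T_c}$. Then the position update rule $$\dot z_i=\kappa\sum_{j\in\mathcal{N}_i(\mathcal{X}_{\sigma(t)})}\sqrt{a_{ij}}\,\hat e_{ij}^{-1}\Omega(|\hat e_{ij}|),\qquad \hat e_{ij}=\sqrt{a_{ij}}\,(z_j(t)-z_i(t)-d_{ji}^* ),$$ solves the displacement formation control problem in predefined time $T_c$. (ii) Let $\mathcal{X}$ be a static connected graph on $n$ vertices and let $\kappa\ge\dfrac{1}{\lambda_2(\mathcal{Q}(\mathcal{X}))\beta(n)^{2-d}T_c}$.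 Then the position update rule $$\dot z_i=\kappa\,\hat e_i^{-1}\Omega(|\hat e_i|),\qquad \hat e_i=\sum_{j\in\mathcal{N}_i(\mathcal{X})}a_{ij}(z_j(t)-z_i(t)-d_{ji}^* ),$$ solves the displacement formation control problem in predefined time $T_c$.
   Context: Formation problem. A displacement formation control rule solves the problem in predefined time $T_c$ if, for every initial condition $z(t_0)\in\mathbb{R}^n$, every trajectory $z(t)$ converges, in a time (measured from $t_0$) at most $T_c$, to a position $\bar z$ satisfying the displacement requirement $\bar z_j-\bar z_i=d_{ji}^*$ for all $i,j$. Graphs. A weighted undirected graph $\mathcal{X}$ has vertex set $\{1,\dots,n\}$, edge set $\mathcal{E}(\mathcal{X})$ (unordered pairs $ij$ of distinct vertices) and weights $a_{ij}=a_{ji}>0$ for $ij\in\mathcal{E}(\mathcal{X})$; $\mathcal{N}_i(\mathcal{X})=\{j: ij\in\mathcal{E}(\mathcal{X})\}$. The Laplacian $\mathcal{Q}(\mathcal{X})$ is the symmetric matrix with $(\mathcal{Q}x)_i=\sum_{j\in\mathcal{N}_i(\mathcal{X})}a_{ij}(x_i-x_j)$, and $\lambda_2(\mathcal{Q}(\mathcal{X}))$ is its smallest nonzero eigenvalue for connected $\mathcal{X}$. Switched dynamic network. $\mathcal{X}_{\sigma(t)}=\langle\mathcal{F},\sigma\rangle$ is a finite collection $\mathcal{F}=\{\mathcal{X}_1,\dots,\mathcal{X}_r\}$ of weighted undirected graphs on the same vertex set together with a switching signal $\sigma:[t_0,\infty)\to\{1,\dots,r\}$, generated exogenously, piecewise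 constant, with a minimum dwell time between consecutive switchings (so finitely many switchings in any finite interval). The weights $a_{ij}$ are those of the currently active graph. Predefined-time consensus function. A monotonically increasing $\Omega:\mathbb{R}\to\mathbb{R}$ for which there are $\hat\Omega:\mathbb{R}_+\to\mathbb{R}_+$ (with $\mathbb{R}_+=[0,\infty)$), a non-increasing $\beta:\mathbb{N}\to(0,\infty)$ and $d\ge1$ such that: (a) for all $n\in\mathbb{N}$ and all $x=(x_1,\dots,x_n)^T$ with $x_i\in\mathbb{R}_+$, $\hat\Omega(\beta(n)\|x\|_2)\le\beta(n)^d\sum_{i=1}^n\Omega(x_i)$; (b) $\Psi(z)=z^{-1}\hat\Omega(|z|)$ has the form $\Psi(z)=\Phi(|z|)^{-1}\mathrm{sign}(z)$ with $\Phi:\mathbb{R}_+\to(0,+\infty]$, $\Phi(0)=+\infty$, $\Phi(z)<+\infty$ for $z>0$, and $\int_0^{+\infty}\Phi(z)\,dz=1$. Conventions. The expression $z^{-1}\Omega(|z|)$ (and $z^{-1}\hat\Omega(|z|)$) is taken to be $0$ at $z=0$. A trajectory is an absolutely continuous function on $[t_0,\infty)$ satisfying the differential equation for almost every $t$.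
   Formalization: The added assumption Ω(0)=0 is needed: if Ω(0)>0, edges with zero error contribute nothing under the convention that z^{-1}Ω(|z|) is 0 at z=0, and part (i) can then fail, with settling time exceeding T_c under switching. *)

theory Defs
  imports "HOL-Analysis.Analysis"
begin

subsection \<open>Weighted undirected graphs\<close>

text \<open>The vertex set is the whole (finite) type. The value \<open>weight X i j\<close> is meaningful only
  when \<open>{i, j}\<close> is an edge.\<close>

record 'v wgraph =
  edges :: "'v set set"
  weight :: "'v \<Rightarrow> 'v \<Rightarrow> real"

definition weighted_graph :: "'v wgraph \<Rightarrow> bool" where
  "weighted_graph X \<longleftrightarrow>
     (\<forall>e\<in>edges X. \<exists>i j. i \<noteq> j \<and> e = {i, j}) \<and>
     (\<forall>i j. {i, j} \<in> edges X \<longrightarrow> weight X i j = weight X j i \<and> weight X i j > 0)"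

definition neighbours :: "'v wgraph \<Rightarrow> 'v \<Rightarrow> 'v set" where
  "neighbours X i = {j. {i, j} \<in> edges X}"

definition connected_graph :: "'v wgraph \<Rightarrow> bool" where
  "connected_graph X \<longleftrightarrow> (\<forall>i j. (\<lambda>u v. v \<in> neighbours X u)\<^sup>*\<^sup>* i j)"

definition laplacian :: "'n::finite wgraph \<Rightarrow> real^'n^'n" where
  "laplacian X = matrix (\<lambda>x. \<chi> i. \<Sum>j\<in>neighbours X i. weight X i j * (x $ i - x $ j))"

lemma laplacian_mult_vec:
  "(laplacian X *v x) $ i = (\<Sum>j\<in>neighbours X i. weight X i j * (x $ i - x $ j))"
proof -
  have "linear (\<lambda>x::real^'a. \<chi> i. \<Sum>j\<in>neighbours X i. weight X i j * (x $ i - x $ j))"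
    by (rule linearI)
      (auto simp: vec_eq_iff algebra_simps sum_distrib_left sum.distrib [symmetric])
  then show ?thesis
    unfolding laplacian_def by (simp add: matrix_works)
qed

definition eigenvalue :: "real^'n^'n \<Rightarrow> real \<Rightarrow> bool" where
  "eigenvalue A \<mu> \<longleftrightarrow> (\<exists>v. v \<noteq> 0 \<and> A *v v = \<mu> *\<^sub>R v)"

definition lambda2 :: "real^'n^'n \<Rightarrow> real" where
  "lambda2 A = Min {\<mu>. eigenvalue A \<mu> \<and> \<mu> \<noteq> 0}"

subsection \<open>Switched dynamic networks\<close>

text \<open>\<open>S\<close> is the set of switching instants and \<open>\<tau>\<close> the minimum dwell time. The value of the signal
  at a switching instant itself is left arbitrary, so that left-continuous and right-continuous
  conventions are both covered.\<close>

definition switching_signal :: "real \<Rightarrow> nat \<Rightarrow> (real \<Rightarrow> nat) \<Rightarrow> bool" where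
  "switching_signal t0 r \<sigma> \<longleftrightarrow>
     (\<forall>t\<ge>t0. \<sigma> t \<in> {1..r}) \<and>
     (\<exists>S \<tau>. S \<subseteq> {t0..} \<and> \<tau> > 0 \<and> (\<forall>s\<in>S. \<forall>s'\<in>S. s \<noteq> s' \<longrightarrow> \<tau> \<le> \<bar>s - s'\<bar>) \<and>
        (\<forall>s t. t0 \<le> s \<and> s \<le> t \<and> {s..t} \<inter> S = {} \<longrightarrow> \<sigma> s = \<sigma> t))"

definition switched_network :: "real \<Rightarrow> nat \<Rightarrow> (nat \<Rightarrow> 'v wgraph) \<Rightarrow> (real \<Rightarrow> nat) \<Rightarrow> bool" where
  "switched_network t0 r F \<sigma> \<longleftrightarrow>
     (\<forall>l\<in>{1..r}. weighted_graph (F l)) \<and> switching_signal t0 r \<sigma>"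

subsection \<open>Predefined-time consensus functions\<close>

text \<open>Here \<open>\<nat>\<close> is \<open>{1, 2, \<dots>}\<close>; the value \<open>\<beta> 0\<close> plays no role. As \<open>inverse 0 = 0\<close>,
  the expression \<open>inverse z * f \<bar>z\<bar>\<close> vanishes at \<open>z = 0\<close>.\<close>

definition predefined_time_consensus_function ::
    "(real \<Rightarrow> real) \<Rightarrow> (real \<Rightarrow> real) \<Rightarrow> (nat \<Rightarrow> real) \<Rightarrow> real \<Rightarrow> bool" where
  "predefined_time_consensus_function \<Omega> \<Omega>h \<beta> d \<longleftrightarrow>
     mono \<Omega> \<and> (\<forall>z\<ge>0. \<Omega>h z \<ge> 0) \<and>
     (\<forall>n\<ge>1. \<beta> n > 0) \<and> (\<forall>m n. 1 \<le> m \<and> m \<le> n \<longrightarrow> \<beta> n \<le> \<beta> m) \<and> d \<ge> 1 \<and>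
     (\<forall>n\<ge>1. \<forall>x::nat \<Rightarrow> real. (\<forall>i\<in>{1..n}. x i \<ge> 0) \<longrightarrow>
        \<Omega>h (\<beta> n * L2_set x {1..n}) \<le> \<beta> n powr d * (\<Sum>i=1..n. \<Omega> (x i))) \<and>
     (\<exists>\<Phi> :: real \<Rightarrow> ennreal.
        \<Phi> 0 = \<infinity> \<and> (\<forall>z>0. 0 < \<Phi> z \<and> \<Phi> z < \<infinity>) \<and>
        (\<forall>z. inverse z * \<Omega>h \<bar>z\<bar> = enn2real (inverse (\<Phi> \<bar>z\<bar>)) * sgn z) \<and>
        \<Phi> \<in> borel_measurable (lebesgue_on {0..}) \<and>
        (\<integral>\<^sup>+ z. \<Phi> z \<partial>lebesgue_on {0..}) = 1)"

subsection \<open>Trajectories and the formation problem\<close>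

text \<open>The finite families of non-overlapping compact intervals in the usual definition of absolute
  continuity are the divisions of their unions.\<close>

definition absolutely_continuous_interval ::
    "real \<Rightarrow> real \<Rightarrow> (real \<Rightarrow> 'a::real_normed_vector) \<Rightarrow> bool" where
  "absolutely_continuous_interval a b f \<longleftrightarrow>
     (\<forall>\<epsilon>>0. \<exists>\<delta>>0. \<forall>D. D division_of \<Union>D \<and> \<Union>D \<subseteq> {a..b} \<and> (\<Sum>K\<in>D. Sup K - Inf K) < \<delta> \<longrightarrow>
        (\<Sum>K\<in>D. norm (f (Sup K) - f (Inf K))) < \<epsilon>)"

text \<open>Absolute continuity on the unbounded interval \<open>[t0, \<infinity>)\<close> means absolute continuity on each of
  its compact subintervals.\<close>

definition trajectory ::
    "real \<Rightarrow> (real \<Rightarrow> real^'n \<Rightarrow> real^'n) \<Rightarrow> (real \<Rightarrow> real^'n) \<Rightarrow> bool" where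
  "trajectory t0 f z \<longleftrightarrow>
     (\<forall>b. absolutely_continuous_interval t0 b z) \<and>
     (AE t in lebesgue. t0 \<le> t \<longrightarrow>
        (z has_vector_derivative f t (z t)) (at t within {t0..}))"

text \<open>\<open>dd j i\<close> is the required displacement of agent \<open>j\<close> from agent \<open>i\<close>.\<close>

definition satisfies_displacement :: "('n \<Rightarrow> 'n \<Rightarrow> real) \<Rightarrow> real^'n \<Rightarrow> bool" where
  "satisfies_displacement dd z \<longleftrightarrow> (\<forall>i j. z $ j - z $ i = dd j i)"

definition solves_formation_problem ::
    "real \<Rightarrow> real \<Rightarrow> ('n \<Rightarrow> 'n \<Rightarrow> real) \<Rightarrow> (real \<Rightarrow> real^'n \<Rightarrow> real^'n) \<Rightarrow> bool" where
  "solves_formation_problem t0 Tc dd f \<longleftrightarrow>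
     (\<forall>z. trajectory t0 f z \<longrightarrow>
        (\<exists>zbar. satisfies_displacement dd zbar \<and>
           (\<exists>T. 0 \<le> T \<and> T \<le> Tc \<and> (\<forall>t\<ge>t0 + T. z t = zbar))))"

definition edge_error :: "'n wgraph \<Rightarrow> ('n \<Rightarrow> 'n \<Rightarrow> real) \<Rightarrow> real^'n \<Rightarrow> 'n \<Rightarrow> 'n \<Rightarrow> real" where
  "edge_error X dd z i j = sqrt (weight X i j) * (z $ j - z $ i - dd j i)"

definition edge_rule ::
    "real \<Rightarrow> (real \<Rightarrow> real) \<Rightarrow> (real \<Rightarrow> 'n wgraph) \<Rightarrow> ('n \<Rightarrow> 'n \<Rightarrow> real) \<Rightarrow>
     real \<Rightarrow> real^'n \<Rightarrow> real^'n" where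
  "edge_rule \<kappa> \<Omega> G dd t z =
     (\<chi> i. \<kappa> * (\<Sum>j\<in>neighbours (G t) i.
        sqrt (weight (G t) i j) *
        (inverse (edge_error (G t) dd z i j) * \<Omega> \<bar>edge_error (G t) dd z i j\<bar>)))"

definition node_error :: "'n wgraph \<Rightarrow> ('n \<Rightarrow> 'n \<Rightarrow> real) \<Rightarrow> real^'n \<Rightarrow> 'n \<Rightarrow> real" where
  "node_error X dd z i = (\<Sum>j\<in>neighbours X i. weight X i j * (z $ j - z $ i - dd j i))"

definition node_rule ::
    "real \<Rightarrow> (real \<Rightarrow> real) \<Rightarrow> 'n wgraph \<Rightarrow> ('n \<Rightarrow> 'n \<Rightarrow> real) \<Rightarrow> real \<Rightarrow> real^'n \<Rightarrow> real^'n" where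
  "node_rule \<kappa> \<Omega> X dd t z =
     (\<chi> i. \<kappa> * (inverse (node_error X dd z i) * \<Omega> \<bar>node_error X dd z i\<bar>))"

end

theory Submission
  imports Defs
begin

text \<open>
  With \<open>x = z - zstar\<close> both rules become consensus protocols, and one scalar Lyapunov argument
  serves both: there is a linear map \<open>B\<close> such that \<open>V = norm (B x)\<close> vanishes exactly when the
  displacement requirement is met, the rule is at rest when \<open>V = 0\<close>, and along trajectories
  \<open>V' \<le> - \<Omega>h V / (Tc * V) = - 1 / (Tc * \<Phi> V)\<close> at almost every time with \<open>V > 0\<close>.
  Separating variables, a time interval of length \<open>T\<close> on which \<open>V > 0\<close> satisfies
  \<open>T / Tc \<le> \<integral>\<Phi> = 1\<close>. Hence \<open>V = 0\<close> from \<open>t0 + Tc\<close> on, and the agents stand still from then on.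

  The separation of variables has to be done for a function \<open>\<Phi>\<close> that is merely Lebesgue measurable
  and for a trajectory that is differentiable almost everywhere only. The fundamental theorem of
  calculus for absolutely continuous functions shows that \<open>V\<close> is nonincreasing; since \<open>V' < 0\<close> at
  almost every time before settling, \<open>V\<close> is injective on a set of full measure, and the change of
  variables formula for injective functions applies there (\<open>decay_time_bound\<close>,
  \<open>predefined_time_settling\<close>).

  The inequality for \<open>V'\<close> combines three ingredients. The rules are skew along edges, respectively
  aligned with the Laplacian \<open>Q\<close>, so that the derivative of \<open>(norm (B x))\<^sup>2 / 2\<close> is a negative
  multiple of a sum of values of \<open>\<Omega>\<close>. The inequality between \<open>\<Omega>h\<close> and sums of
  \<open>\<Omega>\<close> in the definition of a consensus function bounds this sum below by \<open>\<Omega>h\<close> of the norm of the errors, and the monotonicity of \<open>\<Omega>\<close> lets the argument of \<open>\<Omega>h\<close> be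
  replaced by anything smaller, without comparing values of \<open>\<Omega>h\<close> with each other
  (\<open>consensus_function_sum_bound\<close>). Finally the norm of the errors controls \<open>V\<close> by algebraic
  connectivity. For the edge rule, \<open>B\<close> is a multiple of the deviation from the mean, which does not
  depend on the active graph, and one uses \<open>\<lambda>\<^sub>2 * (norm (deviation x))\<^sup>2 \<le> x \<bullet> Q x\<close>; for the node
  rule, \<open>B\<close> is a multiple of the weighted incidence map, with \<open>(norm (B x))\<^sup>2\<close> proportional to
  \<open>x \<bullet> Q x\<close>, and one uses \<open>\<lambda>\<^sub>2 * (x \<bullet> Q x) \<le> (norm (Q x))\<^sup>2\<close>. Both estimates come from the
  minimum of the Rayleigh quotient on the orthogonal complement of the constant vectors.
\<close>

section \<open>Absolutely continuous functions\<close>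

text \<open>
  The Henstock--Kurzweil form of the fundamental theorem of calculus. Tags outside the exceptional
  set \<open>N\<close> contribute little by differentiability. The intervals tagged in \<open>N\<close> are forced by the
  gauge into an open set of small measure, so that their increments are small in total by absolute
  continuity.
\<close>

theorem absolutely_continuous_has_integral_derivative:
  fixes f :: "real \<Rightarrow> 'a::banach"
  assumes ac: "absolutely_continuous_interval a b f" and "a \<le> b"
    and N: "negligible N"
    and der: "\<And>t. t \<in> {a..b} - N \<Longrightarrow> (f has_vector_derivative f' t) (at t within {a..b})"
  shows "(f' has_integral (f b - f a)) {a..b}"
proof -
  \<comment> \<open>On the null set \<open>N\<close> the integrand is irrelevant; with the value \<open>0\<close> the terms tagged there reduce to increments of \<open>f\<close>.\<close>
  define g where "g t = (if t \<in> N then 0 else f' t)" for t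
  have "(g has_integral (f b - f a)) {a..b}"
    unfolding has_integral_real
  proof (intro allI impI)
    fix e :: real
    assume "e > 0"
    define e' where "e' = e / (2 * (b - a + 1))"
    have e': "e' > 0" "e' * (b - a) \<le> e / 2"
      using \<open>e > 0\<close> \<open>a \<le> b\<close> by (auto simp: e'_def field_simps)
    obtain \<delta> where "\<delta> > 0" and
      \<delta>: "\<And>D. D division_of \<Union>D \<Longrightarrow> \<Union>D \<subseteq> {a..b} \<Longrightarrow> (\<Sum>K\<in>D. Sup K - Inf K) < \<delta>
            \<Longrightarrow> (\<Sum>K\<in>D. norm (f (Sup K) - f (Inf K))) < e / 2"
      using ac[unfolded absolutely_continuous_interval_def, rule_format, of "e / 2"] \<open>e > 0\<close>
      by auto
    have Nnull: "N \<in> null_sets lebesgue"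
      using N negligible_iff_null_sets by blast
    then obtain U where U: "open U" "N \<subseteq> U" "U - N \<in> lmeasurable"
        "emeasure lebesgue (U - N) < ennreal \<delta>"
      using sets_lebesgue_outer_open[of N \<delta>] \<open>\<delta> > 0\<close> by blast
    have "U = (U - N) \<union> N" using U(2) by auto
    then have "U \<in> lmeasurable"
      using fmeasurable.Un[OF U(3) negligible_imp_measurable[OF N]] by simp
    have "emeasure lebesgue U = emeasure lebesgue (U - N)"
      using Nnull \<open>U \<in> lmeasurable\<close> by (simp add: emeasure_Diff_null_set fmeasurableD)
    then have "ennreal (measure lebesgue U) < ennreal \<delta>"
      using U(4) \<open>U \<in> lmeasurable\<close> by (simp add: emeasure_eq_measure2)
    then have mU: "measure lebesgue U < \<delta>"
      by (simp add: ennreal_less_iff)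
    define good where "good t r \<longleftrightarrow> r > 0 \<and> (t \<in> N \<longrightarrow> ball t r \<subseteq> U) \<and>
        (t \<in> {a..b} - N \<longrightarrow> (\<forall>y\<in>{a..b}. norm (y - t) < r \<longrightarrow>
           norm (f y - f t - (y - t) *\<^sub>R f' t) \<le> e' * norm (y - t)))" for t r
    have "\<exists>r. good t r" for t
    proof (cases "t \<in> N")
      case True
      then obtain r where "r > 0" "ball t r \<subseteq> U"
        using U(1,2) open_contains_ball by blast
      then show ?thesis using True unfolding good_def by blast
    next
      case False
      show ?thesis
      proof (cases "t \<in> {a..b}")
        case True
        then have "\<exists>r>0. \<forall>y\<in>{a..b}. norm (y - t) < r \<longrightarrow>
            norm (f y - f t - (y - t) *\<^sub>R f' t) \<le> e' * norm (y - t)"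
          using der[of t] e'(1) False
          unfolding has_vector_derivative_def has_derivative_within_alt by blast
        then show ?thesis using False unfolding good_def by blast
      next
        case False
        then show ?thesis using \<open>t \<notin> N\<close> unfolding good_def by (intro exI[of _ 1]) auto
      qed
    qed
    then obtain r where "\<And>t. good t (r t)"
      by metis
    then have r: "\<And>t. r t > 0" "\<And>t. t \<in> N \<Longrightarrow> ball t (r t) \<subseteq> U"
      "\<And>t y. t \<in> {a..b} - N \<Longrightarrow> y \<in> {a..b} \<Longrightarrow> norm (y - t) < r t \<Longrightarrow>
           norm (f y - f t - (y - t) *\<^sub>R f' t) \<le> e' * norm (y - t)"
      unfolding good_def by blast+
    show "\<exists>\<gamma>. gauge \<gamma> \<and> (\<forall>p. p tagged_division_of {a..b} \<and> \<gamma> fine p \<longrightarrow>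
        norm ((\<Sum>(x, K)\<in>p. measure lborel K *\<^sub>R g x) - (f b - f a)) < e)"
    proof (intro exI[of _ "\<lambda>t. ball t (r t)"] conjI allI impI)
      show "gauge (\<lambda>t. ball t (r t))"
        using r(1) gauge_ball_dependent by blast
    next
      fix p
      assume "p tagged_division_of {a..b} \<and> (\<lambda>t. ball t (r t)) fine p"
      then have p: "p tagged_division_of {a..b}" and fine: "(\<lambda>t. ball t (r t)) fine p"
        by auto
      have "finite p" using p by blast
      have ba: "b - a = (\<Sum>(x, K)\<in>p. Sup K - Inf K)"
        "f b - f a = (\<Sum>(x, K)\<in>p. f (Sup K) - f (Inf K))"
        using additive_tagged_division_1[where f = "\<lambda>x. x"] additive_tagged_division_1[where f = f]
          \<open>a \<le> b\<close> p by auto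
      have interval: "\<exists>u v. K = {u..v} \<and> u \<le> x \<and> x \<le> v \<and> a \<le> u \<and> v \<le> b"
        if xK: "(x, K) \<in> p" for x K
      proof -
        obtain u v where "K = cbox u v" "x \<in> K" "K \<subseteq> {a..b}"
          using tagged_division_ofD(2-4)[OF p xK] by blast
        then show ?thesis by (auto intro!: exI[of _ u] exI[of _ v])
      qed
      \<comment> \<open>\<open>Sup {}\<close> and \<open>Inf {}\<close> are unspecified reals, so the empty interval is treated separately.\<close>
      define h where "h K = (if K = {} then 0 else norm (f (Sup K) - f (Inf K)))" for K
      define q where "q = {(x, K) \<in> p. x \<in> N}"
      have term_bound: "norm (measure lborel K *\<^sub>R g x - (f (Sup K) - f (Inf K)))
          \<le> e' * (Sup K - Inf K) + (if x \<in> N then h K else 0)" if xK: "(x, K) \<in> p" for x K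
      proof -
        obtain u v where K: "K = {u..v}" and uv: "u \<le> x" "x \<le> v" "a \<le> u" "v \<le> b"
          using interval[OF xK] by blast
        show ?thesis
        proof (cases "x \<in> N")
          case True
          then show ?thesis using K uv e' by (simp add: g_def h_def norm_minus_commute)
        next
          case False
          have "K \<subseteq> ball x (r x)" using fine xK by (auto simp: fine_def)
          moreover have "u \<in> K" "v \<in> K" using K uv by auto
          ultimately have near: "norm (u - x) < r x" "norm (v - x) < r x"
            by (auto simp: dist_norm norm_minus_commute)
          have "norm ((v - u) *\<^sub>R f' x - (f v - f u))
              = norm ((f u - f x - (u - x) *\<^sub>R f' x) - (f v - f x - (v - x) *\<^sub>R f' x))"
            by (auto simp: algebra_simps)
          also have "\<dots> \<le> norm (f u - f x - (u - x) *\<^sub>R f' x) + norm (f v - f x - (v - x) *\<^sub>R f' x)"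
            by (rule norm_triangle_ineq4)
          also have "\<dots> \<le> e' * norm (u - x) + e' * norm (v - x)"
            using False uv near by (intro add_mono r(3)) auto
          also have "\<dots> = e' * (v - u)" using uv by (auto simp: algebra_simps)
          finally show ?thesis using K uv False by (simp add: g_def)
        qed
      qed
      have "q \<subseteq> p" by (auto simp: q_def)
      then have q: "q tagged_division_of \<Union>(snd ` q)"
        using p tagged_partial_division_subset[OF _ \<open>q \<subseteq> p\<close>]
        by (intro tagged_partial_division_of_Union_self) (auto simp: tagged_division_of_def)
      have qdiv: "snd ` q division_of \<Union>(snd ` q)"
        using division_of_tagged_division[OF q] .
      have "(\<Sum>K\<in>snd ` q. h K) \<le> (\<Sum>K\<in>snd ` q. norm (f (Sup K) - f (Inf K)))"
        by (rule sum_mono) (simp add: h_def)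
      also have "\<dots> < e / 2"
      proof (rule \<delta>[OF qdiv])
        show "\<Union>(snd ` q) \<subseteq> {a..b}" using p \<open>q \<subseteq> p\<close> by fastforce
        have "(\<Sum>K\<in>snd ` q. Sup K - Inf K) = sum (measure lebesgue) (snd ` q)"
        proof (rule sum.cong[OF refl])
          fix K assume "K \<in> snd ` q"
          then obtain u v where "K = {u..v}" "u \<le> v"
            using \<open>q \<subseteq> p\<close> interval by force
          then show "Sup K - Inf K = measure lebesgue K" by simp
        qed
        also have "\<dots> = measure lebesgue (\<Union>(snd ` q))"
          by (rule content_division[OF qdiv])
        also have "\<dots> \<le> measure lebesgue U"
        proof (rule measure_mono_fmeasurable[OF _ _ \<open>U \<in> lmeasurable\<close>])
          show "\<Union>(snd ` q) \<subseteq> U"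
            using fine r(2) by (fastforce simp: q_def fine_def)
          show "\<Union>(snd ` q) \<in> sets lebesgue"
            using qdiv by (simp add: fmeasurableD lmeasurable_division)
        qed
        finally show "(\<Sum>K\<in>snd ` q. Sup K - Inf K) < \<delta>" using mU by simp
      qed
      finally have "(\<Sum>K\<in>snd ` q. h K) < e / 2" .
      moreover have "(\<Sum>(x, K)\<in>q. h K) = (\<Sum>K\<in>snd ` q. h K)"
        by (rule sum.over_tagged_division_lemma[OF q])
          (auto simp: h_def box_eq_empty cbox_interval split: if_splits)
      moreover have "(\<Sum>(x, K)\<in>p. if x \<in> N then h K else 0) = (\<Sum>(x, K)\<in>q. h K)"
        unfolding q_def using \<open>finite p\<close>
        by (intro sum.mono_neutral_cong_right) (auto split: if_splits)
      ultimately have bad: "(\<Sum>(x, K)\<in>p. if x \<in> N then h K else 0) < e / 2"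
        by simp
      have "norm ((\<Sum>(x, K)\<in>p. measure lborel K *\<^sub>R g x) - (f b - f a))
          = norm (\<Sum>(x, K)\<in>p. measure lborel K *\<^sub>R g x - (f (Sup K) - f (Inf K)))"
        by (simp add: ba(2) sum_subtractf[symmetric] case_prod_unfold)
      also have "\<dots> \<le> (\<Sum>(x, K)\<in>p. e' * (Sup K - Inf K) + (if x \<in> N then h K else 0))"
        by (rule sum_norm_le) (use term_bound in auto)
      also have "\<dots> = e' * (b - a) + (\<Sum>(x, K)\<in>p. if x \<in> N then h K else 0)"
        by (simp add: ba(1) sum_distrib_left sum.distrib case_prod_unfold)
      also have "\<dots> < e" using bad e'(2) by simp
      finally show "norm ((\<Sum>(x, K)\<in>p. measure lborel K *\<^sub>R g x) - (f b - f a)) < e" .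
    qed
  qed
  then show ?thesis
    by (rule has_integral_spike[OF N, rotated]) (auto simp: g_def)
qed

lemma absolutely_continuous_lipschitz_image:
  assumes "absolutely_continuous_interval a b f" and "K > 0"
    and lip: "\<And>s t. norm (g s - g t) \<le> K * norm (f s - f t)"
  shows "absolutely_continuous_interval a b g"
  unfolding absolutely_continuous_interval_def
proof (intro allI impI)
  fix e :: real
  assume "e > 0"
  then obtain \<delta> where "\<delta> > 0" and
    \<delta>: "\<And>D. D division_of \<Union>D \<and> \<Union>D \<subseteq> {a..b} \<and> (\<Sum>I\<in>D. Sup I - Inf I) < \<delta>
          \<Longrightarrow> (\<Sum>I\<in>D. norm (f (Sup I) - f (Inf I))) < e / K"
    using assms(1)[unfolded absolutely_continuous_interval_def, rule_format, of "e / K"] \<open>K > 0\<close>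
    by auto
  show "\<exists>\<delta>>0. \<forall>D. D division_of \<Union>D \<and> \<Union>D \<subseteq> {a..b} \<and> (\<Sum>I\<in>D. Sup I - Inf I) < \<delta> \<longrightarrow>
      (\<Sum>I\<in>D. norm (g (Sup I) - g (Inf I))) < e"
  proof (intro exI[of _ \<delta>] conjI allI impI \<open>\<delta> > 0\<close>)
    fix D
    assume D: "D division_of \<Union>D \<and> \<Union>D \<subseteq> {a..b} \<and> (\<Sum>I\<in>D. Sup I - Inf I) < \<delta>"
    have "(\<Sum>I\<in>D. norm (g (Sup I) - g (Inf I))) \<le> K * (\<Sum>I\<in>D. norm (f (Sup I) - f (Inf I)))"
      unfolding sum_distrib_left by (rule sum_mono) (rule lip)
    also have "\<dots> < e"
      using \<delta>[OF D] \<open>K > 0\<close> by (simp add: field_simps)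
    finally show "(\<Sum>I\<in>D. norm (g (Sup I) - g (Inf I))) < e" .
  qed
qed

lemma absolutely_continuous_interval_subset:
  assumes "absolutely_continuous_interval a b f" "{c..d} \<subseteq> {a..b}"
  shows "absolutely_continuous_interval c d f"
  using assms unfolding absolutely_continuous_interval_def by (meson order_trans)

lemma absolutely_continuous_imp_continuous_on:
  assumes ac: "absolutely_continuous_interval a b f"
  shows "continuous_on {a..b} f"
proof -
  have *: "\<exists>\<delta>>0. \<forall>s t. a \<le> s \<and> s \<le> t \<and> t \<le> b \<and> t - s < \<delta> \<longrightarrow> norm (f t - f s) < e"
    if "e > 0" for e
  proof -
    obtain \<delta> where "\<delta> > 0" and
      \<delta>: "\<And>D. D division_of \<Union>D \<and> \<Union>D \<subseteq> {a..b} \<and> (\<Sum>I\<in>D. Sup I - Inf I) < \<delta>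
            \<Longrightarrow> (\<Sum>I\<in>D. norm (f (Sup I) - f (Inf I))) < e"
      using ac[unfolded absolutely_continuous_interval_def, rule_format, OF \<open>e > 0\<close>] by auto
    show ?thesis
    proof (intro exI[of _ \<delta>] conjI allI impI \<open>\<delta> > 0\<close>)
      fix s t
      assume st: "a \<le> s \<and> s \<le> t \<and> t \<le> b \<and> t - s < \<delta>"
      have "{{s..t}} division_of {s..t}"
        using division_of_self[of s t] st by (simp add: box_real)
      then show "norm (f t - f s) < e"
        using \<delta>[of "{{s..t}}"] st by simp
    qed
  qed
  show ?thesis
    unfolding continuous_on_iff
  proof (intro ballI allI impI)
    fix s e :: real
    assume s: "s \<in> {a..b}" and "e > 0"
    obtain \<delta> where \<delta>: "\<delta> > 0"
      "\<And>s t. a \<le> s \<Longrightarrow> s \<le> t \<Longrightarrow> t \<le> b \<Longrightarrow> t - s < \<delta> \<Longrightarrow> norm (f t - f s) < e"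
      using *[OF \<open>e > 0\<close>] by blast
    have "dist (f t) (f s) < e" if t: "t \<in> {a..b}" "dist t s < \<delta>" for t
      using \<delta>(2)[of s t] \<delta>(2)[of t s] s t
      by (cases "s \<le> t") (auto simp: dist_norm norm_minus_commute)
    then show "\<exists>\<delta>>0. \<forall>t\<in>{a..b}. dist t s < \<delta> \<longrightarrow> dist (f t) (f s) < e"
      using \<delta>(1) by blast
  qed
qed

section \<open>Settling in predefined time\<close>

text \<open>
  Separation of variables: formally \<open>c * (b - a) \<le> \<integral>\<bar>V'\<bar> * \<phi> (V t) dt = \<integral>\<phi> dV \<le> 1\<close>. As \<open>\<phi>\<close>
  may be discontinuous, its indefinite integral cannot simply be composed with \<open>V\<close> and differentiated;
  but \<open>V\<close> is strictly decreasing on the set where its negative derivative exists, and the change of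
  variables formula holds on measurable sets of injectivity.
\<close>

lemma decay_time_bound:
  fixes V v \<phi> :: "real \<Rightarrow> real"
  assumes int: "\<phi> absolutely_integrable_on {0..}" and int1: "integral {0..} \<phi> \<le> 1"
    and \<phi>: "\<And>z. \<phi> z \<ge> 0"
    and "a < b" and N: "negligible N"
    and pos: "\<And>t. t \<in> {a..b} \<Longrightarrow> V t > 0"
    and anti: "\<And>s t. a \<le> s \<Longrightarrow> s \<le> t \<Longrightarrow> t \<le> b \<Longrightarrow> V t \<le> V s"
    and der: "\<And>t. t \<in> {a..b} - N \<Longrightarrow> (V has_real_derivative v t) (at t within {a..b})"
    and neg: "\<And>t. t \<in> {a..b} - N \<Longrightarrow> v t < 0"
    and decay: "\<And>t. t \<in> {a..b} - N \<Longrightarrow> c \<le> \<bar>v t\<bar> * \<phi> (V t)"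
  shows "c * (b - a) \<le> 1"
proof -
  \<comment> \<open>At points other than \<open>b\<close> the derivative is determined by the values to the right.\<close>
  define S where "S = {a..b} - N - {b}"
  have S: "S \<subseteq> {a..b}" "S \<subseteq> {a..b} - N"
    by (auto simp: S_def)
  have "N \<in> sets lebesgue" using N negligible_iff_null_sets by blast
  then have Smeas: "S \<in> sets lebesgue" unfolding S_def by (intro sets.Diff) auto
  have derS: "(V has_real_derivative v t) (at t within S)" if "t \<in> S" for t
    by (rule DERIV_subset[OF der[of t]]) (use that S in auto)
  have less: "V t < V s" if st: "s \<in> S" "t \<in> S" "s < t" for s t
  proof (rule ccontr)
    assume "\<not> V t < V s"
    have ab: "a \<le> s" "t \<le> b" using st(1,2) S(1) by auto
    have const: "V x = V s" if "x \<in> {s..t}" for x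
      using anti[of s x] anti[of x t] that ab \<open>\<not> V t < V s\<close> by simp
    have "(V has_real_derivative v s) (at s within {s..t})"
      by (rule DERIV_subset[OF der[of s]]) (use ab st(1) S(2) in auto)
    moreover have "(V has_real_derivative 0) (at s within {s..t})"
    proof (rule has_field_derivative_transform_within[where f = "\<lambda>_. V s" and d = 1])
      show "((\<lambda>_. V s) has_real_derivative 0) (at s within {s..t})" by simp
      show "s \<in> {s..t}" using st(3) by simp
      show "V s = V x" if "x \<in> {s..t}" for x using const[OF that] by (rule sym)
    qed simp
    moreover have "at s within {s..t} \<noteq> bot"
      using st(3) by (simp add: at_within_Icc_at_right)
    ultimately have "v s = 0"
      unfolding has_real_derivative_iff_has_vector_derivative
      by (rule vector_derivative_unique_within[rotated])
    then show False using neg[of s] st(1) S(2) by auto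
  qed

  then have inj: "inj_on V S"
    by (intro inj_onI) (metis less_irrefl linorder_neqE_linordered_idom)
  have image: "V ` S \<subseteq> {0..}" using pos S(1) by (force intro: less_imp_le)
  have "V differentiable_on S"
    unfolding differentiable_on_def
    using derS by (meson field_differentiable_def field_differentiable_imp_differentiable)
  then have imageS: "V ` S \<in> sets lebesgue"
    using Smeas by (intro differentiable_image_in_sets_lebesgue) auto
  have intV: "\<phi> absolutely_integrable_on V ` S"
    using set_integrable_subset[OF int imageS image] .
  have cov: "(\<lambda>t. \<bar>v t\<bar> * \<phi> (V t)) absolutely_integrable_on S"
      "integral S (\<lambda>t. \<bar>v t\<bar> * \<phi> (V t)) = integral (V ` S) \<phi>"
    using has_absolute_integral_change_of_variables_1'[OF Smeas derS inj, of \<phi> "integral (V ` S) \<phi>"]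
      intV by auto
  have null: "negligible {x \<in> {a..b} - S. c \<noteq> 0}"
    by (rule negligible_subset[of "N \<union> {b}"]) (use N in \<open>auto simp: S_def intro: negligible_Un\<close>)
  have "((\<lambda>t. c) has_integral c * (b - a)) {a..b}"
    using has_integral_const_real[of c a b] \<open>a < b\<close> by (simp add: mult.commute)
  then have const: "((\<lambda>t. c) has_integral c * (b - a)) S"
    using S(1) null by (subst has_integral_spike_set_eq[of _ "{a..b}"]) (auto simp: Diff_eq_empty_iff[THEN iffD2])
  have "c * (b - a) \<le> integral S (\<lambda>t. \<bar>v t\<bar> * \<phi> (V t))"
    using const integrable_integral[OF absolutely_integrable_on_def[THEN iffD1, OF cov(1), THEN conjunct1]]
    by (rule has_integral_le) (use decay S in auto)
  also have "\<dots> \<le> integral {0..} \<phi>"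
    unfolding cov(2) using image intV int \<phi>
    by (intro integral_subset_le) (auto simp: absolutely_integrable_on_def)
  finally show ?thesis using int1 by simp
qed

text \<open>
  At a zero of \<open>y\<close> the norm is not differentiable, but the composition is as soon as \<open>y\<close> has
  derivative zero there. The stated value covers this case because division by \<open>0\<close> yields \<open>0\<close>.
\<close>

lemma has_real_derivative_norm_at:
  fixes y :: "real \<Rightarrow> 'b::real_inner"
  assumes y: "(y has_vector_derivative w) (at t within S)"
    and zero: "y t = 0 \<Longrightarrow> w = 0"
  shows "((\<lambda>s. norm (y s)) has_real_derivative (y t \<bullet> w / norm (y t))) (at t within S)"
proof (cases "y t = 0")
  case True
  have "((\<lambda>s. norm (y s)) has_derivative (\<lambda>h. 0 * h)) (at t within S)"
    unfolding has_derivative_within_alt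
  proof
    show "bounded_linear (\<lambda>h::real. 0 * h)" by (rule bounded_linear_mult_right)
  qed (use y True zero in \<open>simp add: has_vector_derivative_def has_derivative_within_alt\<close>)
  moreover have "y t \<bullet> w / norm (y t) = 0" using True by simp
  ultimately show ?thesis
    unfolding has_field_derivative_def by (simp only:)
next
  case False
  have "((\<lambda>s. norm (y s)) has_derivative (\<lambda>h. (h *\<^sub>R w) \<bullet> sgn (y t))) (at t within S)"
    using y False unfolding has_vector_derivative_def
    by (intro has_derivative_compose[of y _ _ _ norm]) (auto intro: has_derivative_norm)
  moreover have "(h *\<^sub>R w) \<bullet> sgn (y t) = (y t \<bullet> w / norm (y t)) * h" for h
    by (simp add: sgn_div_norm inner_commute field_simps)
  ultimately show ?thesis
    unfolding has_field_derivative_def by (simp only:)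
qed

text \<open>
  A real-valued version of \<open>\<Phi>\<close>, suited to the Henstock--Kurzweil integral. The infinite value of
  \<open>\<Phi>\<close> at \<open>0\<close> is turned into \<open>0\<close>, which affects a null set only.
\<close>

lemma consensus_function_profile:
  assumes "predefined_time_consensus_function \<Omega> \<Omega>h \<beta> d"
  obtains \<phi> :: "real \<Rightarrow> real" where
    "\<phi> absolutely_integrable_on {0..}" "integral {0..} \<phi> \<le> 1" "\<And>z. \<phi> z \<ge> 0"
    "\<And>z. z > 0 \<Longrightarrow> \<phi> z > 0 \<and> \<Omega>h z = z / \<phi> z"
proof -
  obtain \<Phi> :: "real \<Rightarrow> ennreal" where \<Phi>: "\<And>z. z > 0 \<Longrightarrow> 0 < \<Phi> z \<and> \<Phi> z < \<infinity>"
      "\<And>z. inverse z * \<Omega>h \<bar>z\<bar> = enn2real (inverse (\<Phi> \<bar>z\<bar>)) * sgn z"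
      "\<Phi> \<in> borel_measurable (lebesgue_on {0..})"
      "(\<integral>\<^sup>+ z. \<Phi> z \<partial>lebesgue_on {0..}) = 1"
    using assms unfolding predefined_time_consensus_function_def by blast
  define \<phi> where "\<phi> z = enn2real (\<Phi> z)" for z
  have "\<phi> z \<ge> 0" for z by (simp add: \<phi>_def)
  have meas: "\<phi> \<in> borel_measurable (lebesgue_on {0..})"
    unfolding \<phi>_def using \<Phi>(3) by simp
  have "ennreal (\<phi> z) \<le> \<Phi> z" for z
    unfolding \<phi>_def by (cases "\<Phi> z") auto
  then have le: "(\<integral>\<^sup>+ z. ennreal (\<phi> z) \<partial>lebesgue_on {0..}) \<le> 1"
    using nn_integral_mono[of "lebesgue_on {0..}" "\<lambda>z. ennreal (\<phi> z)" \<Phi>] \<Phi>(4) by simp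
  have int: "integrable (lebesgue_on {0..}) \<phi>"
    using meas le by (intro integrableI_nonneg) (auto simp: \<phi>_def intro: le_less_trans)
  then have abs: "\<phi> absolutely_integrable_on {0..}"
    using meas \<open>\<And>z. \<phi> z \<ge> 0\<close> by (simp add: absolutely_integrable_measurable_real)
  have "ennreal (integral\<^sup>L (lebesgue_on {0..}) \<phi>) \<le> 1"
    using le int by (subst (asm) nn_integral_eq_integral) (auto simp: \<phi>_def)
  then have "integral\<^sup>L (lebesgue_on {0..}) \<phi> \<le> 1"
    by simp
  then have "integral {0..} \<phi> \<le> 1"
    using lebesgue_integral_eq_integral[OF int] by simp
  moreover have "\<phi> z > 0 \<and> \<Omega>h z = z / \<phi> z" if "z > 0" for z
  proof -
    have pos: "\<phi> z > 0"
      using \<Phi>(1)[OF that] by (simp add: \<phi>_def enn2real_positive_iff)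
    then have "\<Phi> z = ennreal (\<phi> z)"
      using \<Phi>(1)[OF that] by (simp add: \<phi>_def)
    then have "enn2real (inverse (\<Phi> z)) = inverse (\<phi> z)"
      using pos by (simp add: inverse_ennreal)
    then show ?thesis
      using \<Phi>(2)[of z] that pos by (simp add: field_simps)
  qed
  ultimately show thesis
    using that[of \<phi>] abs by (simp add: \<phi>_def)
qed

text \<open>
  The Lyapunov argument in the form common to both rules. Any multiplicative constant is part of
  \<open>B\<close>. The hypothesis on rest states has two purposes: it makes \<open>norm (B (z t - p))\<close> differentiable at
  its zeros, and it freezes the trajectory once \<open>B (z t - p)\<close> vanishes.
\<close>

theorem predefined_time_settling:
  fixes z :: "real \<Rightarrow> real^'n" and B :: "real^'n \<Rightarrow> 'b::euclidean_space"
  assumes \<Omega>: "predefined_time_consensus_function \<Omega> \<Omega>h \<beta> d"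
    and traj: "trajectory t0 f z" and "linear B" and "Tc > 0"
    and rest: "\<And>t. t \<ge> t0 \<Longrightarrow> B (z t - p) = 0 \<Longrightarrow> f t (z t) = 0"
    and decay: "\<And>t. t \<ge> t0 \<Longrightarrow>
      B (z t - p) \<bullet> B (f t (z t)) \<le> - (1 / Tc) * \<Omega>h (norm (B (z t - p)))"
  shows "B (z (t0 + Tc) - p) = 0" and "t \<ge> t0 + Tc \<Longrightarrow> z t = z (t0 + Tc)"
proof -
  obtain \<phi> where \<phi>: "\<phi> absolutely_integrable_on {0..}" "integral {0..} \<phi> \<le> 1" "\<And>z. \<phi> z \<ge> 0"
    "\<And>z. z > 0 \<Longrightarrow> \<phi> z > 0 \<and> \<Omega>h z = z / \<phi> z"
    using consensus_function_profile[OF \<Omega>] by blast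
  have \<Omega>h: "\<Omega>h x \<ge> 0" if "x \<ge> 0" for x
    using \<Omega> that unfolding predefined_time_consensus_function_def by blast
  define y where "y t = B (z t - p)" for t
  define w where "w t = B (f t (z t))" for t
  define V where "V t = norm (y t)" for t
  define v where "v t = y t \<bullet> w t / norm (y t)" for t
  have "bounded_linear B" using \<open>linear B\<close> by (simp add: linear_conv_bounded_linear)
  have ac: "absolutely_continuous_interval t0 b z" for b
    using traj by (simp add: trajectory_def)
  obtain N where N: "negligible N"
    and derz: "\<And>t. t \<ge> t0 \<Longrightarrow> t \<notin> N \<Longrightarrow> (z has_vector_derivative f t (z t)) (at t within {t0..})"
    using traj unfolding trajectory_def eventually_ae_filter_negligible by blast
  have derV: "(V has_real_derivative v t) (at t within {t0..})" if "t \<ge> t0" "t \<notin> N" for t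
  proof -
    have "((\<lambda>s. z s - p) has_vector_derivative f t (z t)) (at t within {t0..})"
      using derz[OF that] by (auto intro!: derivative_eq_intros)
    then have "(y has_vector_derivative w t) (at t within {t0..})"
      unfolding y_def w_def by (rule bounded_linear.has_vector_derivative[OF \<open>bounded_linear B\<close>])
    moreover have "y t = 0 \<Longrightarrow> w t = 0"
      using rest[OF that(1)] \<open>linear B\<close> by (simp add: y_def w_def linear_0)
    ultimately show ?thesis
      unfolding V_def v_def by (rule has_real_derivative_norm_at)
  qed
  obtain K where K: "K > 0" "\<And>x. norm (B x) \<le> K * norm x"
    using linear_bounded_pos[OF \<open>linear B\<close>] by blast
  have acV: "absolutely_continuous_interval t0 b V" for b
  proof (rule absolutely_continuous_lipschitz_image[OF ac K(1)])
    fix s t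
    have "norm (V s - V t) \<le> norm (y s - y t)"
      unfolding V_def by (simp add: norm_triangle_ineq3)
    also have "y s - y t = B (z s - z t)"
      unfolding y_def by (simp add: linear_diff[OF \<open>linear B\<close>, symmetric])
    finally show "norm (V s - V t) \<le> K * norm (z s - z t)"
      using K(2)[of "z s - z t"] by simp
  qed
  have yw: "y t \<bullet> w t \<le> - (1 / Tc) * \<Omega>h (V t)" if "t \<ge> t0" for t
    using decay[OF that] by (simp add: y_def w_def V_def)
  have v_nonpos: "v t \<le> 0" if "t \<ge> t0" for t
  proof -
    have "\<Omega>h (V t) / Tc \<ge> 0" using \<Omega>h[of "V t"] \<open>Tc > 0\<close> by (simp add: V_def)
    then have "y t \<bullet> w t \<le> 0" using yw[OF that] by simp
    then show ?thesis unfolding v_def by (simp add: divide_nonpos_nonneg)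
  qed
  have anti: "V t \<le> V s" if "t0 \<le> s" "s \<le> t" for s t
  proof -
    have "(v has_integral (V t - V s)) {s..t}"
    proof (rule absolutely_continuous_has_integral_derivative[OF _ that(2) N])
      show "absolutely_continuous_interval s t V"
        by (rule absolutely_continuous_interval_subset[OF acV[of t]]) (use that in auto)
      show "(V has_vector_derivative v x) (at x within {s..t})" if "x \<in> {s..t} - N" for x
        unfolding has_real_derivative_iff_has_vector_derivative[symmetric]
        by (rule DERIV_subset[OF derV]) (use that \<open>t0 \<le> s\<close> in auto)
    qed
    then have "V t - V s \<le> 0"
      by (rule has_integral_le[where g = "\<lambda>_. 0" and j = 0]) (use v_nonpos that in auto)
    then show ?thesis by simp
  qed
  have late: "V t = 0" if t: "t > t0 + Tc" for t
  proof (rule ccontr)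
    assume "V t \<noteq> 0"
    then have "V t > 0" by (simp add: V_def)
    have pos: "V s > 0" if "s \<in> {t0..t}" for s
      using anti[of s t] that \<open>V t > 0\<close> by simp
    have rate: "v s \<le> - (1 / Tc) / \<phi> (V s)" if s: "s \<in> {t0..t}" for s
    proof -
      have "v s \<le> - (1 / Tc) * \<Omega>h (V s) / V s"
        unfolding v_def V_def[symmetric] using s
        by (intro divide_right_mono yw) (auto simp: V_def)
      also have "\<dots> = - (1 / Tc) / \<phi> (V s)"
        using \<phi>(4)[OF pos[OF s]] pos[OF s] by simp
      finally show ?thesis .
    qed
    have "(1 / Tc) * (t - t0) \<le> 1"
    proof (rule decay_time_bound[OF \<phi>(1,2,3) _ N pos])
      show "t0 < t" using t \<open>Tc > 0\<close> by simp
      show "V r \<le> V s" if "t0 \<le> s" "s \<le> r" "r \<le> t" for s r using anti that by simp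
    next
      fix s assume s: "s \<in> {t0..t} - N"
      show "(V has_real_derivative v s) (at s within {t0..t})"
        by (rule DERIV_subset[OF derV]) (use s in auto)
      have "\<phi> (V s) > 0" using \<phi>(4) pos s by simp
      then have "(1 / Tc) / \<phi> (V s) > 0" using \<open>Tc > 0\<close> by simp
      moreover have "v s \<le> - ((1 / Tc) / \<phi> (V s))" using rate[of s] s by simp
      ultimately show "v s < 0" by linarith
      have "1 / Tc / \<phi> (V s) \<le> \<bar>v s\<bar>"
        using \<open>v s \<le> - ((1 / Tc) / \<phi> (V s))\<close> by linarith
      then show "1 / Tc \<le> \<bar>v s\<bar> * \<phi> (V s)"
        using pos_divide_le_eq[OF \<open>\<phi> (V s) > 0\<close>] by blast
    qed
    then show False using t \<open>Tc > 0\<close> by (simp add: field_simps)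
  qed
  \<comment> \<open>The bound gives \<open>V t = 0\<close> for \<open>t > t0 + Tc\<close> only; the endpoint follows by continuity.\<close>
  have "continuous_on (closure {t0 + Tc<..<t0 + Tc + 1}) V"
    using absolutely_continuous_imp_continuous_on[OF acV[of "t0 + Tc + 1"]] \<open>Tc > 0\<close>
    by (auto intro: continuous_on_subset)
  then have "V (t0 + Tc) = 0"
    by (rule continuous_constant_on_closure) (use late in auto)
  then show "B (z (t0 + Tc) - p) = 0" by (simp add: V_def y_def)
  then have still: "f s (z s) = 0" if "s \<ge> t0 + Tc" for s
    using rest[of s] late[of s] that \<open>Tc > 0\<close>
    by (cases "s = t0 + Tc") (auto simp: V_def y_def)
  show "z t = z (t0 + Tc)" if t: "t \<ge> t0 + Tc"
  proof -
    have "((\<lambda>s. f s (z s)) has_integral (z t - z (t0 + Tc))) {t0 + Tc..t}"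
    proof (rule absolutely_continuous_has_integral_derivative[OF _ t N])
      show "absolutely_continuous_interval (t0 + Tc) t z"
        by (rule absolutely_continuous_interval_subset[OF ac[of t]]) (use \<open>Tc > 0\<close> in auto)
      show "(z has_vector_derivative f x (z x)) (at x within {t0 + Tc..t})"
        if "x \<in> {t0 + Tc..t} - N" for x
        by (rule has_vector_derivative_within_subset[OF derz]) (use that \<open>Tc > 0\<close> in auto)
    qed
    moreover have "((\<lambda>s. f s (z s)) has_integral 0) {t0 + Tc..t}"
      by (rule has_integral_is_0) (use still in auto)
    ultimately have "z t - z (t0 + Tc) = 0"
      by (rule has_integral_unique)
    then show ?thesis by simp
  qed
qed

section \<open>Laplacians and algebraic connectivity\<close>

lemma weight_pos: "weighted_graph X \<Longrightarrow> {i, j} \<in> edges X \<Longrightarrow> weight X i j > 0"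
  by (simp add: weighted_graph_def)

lemma weight_commute:
  assumes "weighted_graph X" and "{i, j} \<in> edges X"
  shows "weight X j i = weight X i j"
  using assms(1)[unfolded weighted_graph_def, THEN conjunct2, rule_format, OF assms(2)]
  by (auto dest: sym)

text \<open>
  Every edge occurs in both orientations, so that sums over the neighbours of all vertices are sums
  over arcs.
\<close>

definition arcs :: "'v wgraph \<Rightarrow> ('v \<times> 'v) set" where
  "arcs X = {(i, j). {i, j} \<in> edges X}"

lemma sum_neighbours_eq_sum_arcs:
  fixes g :: "'v::finite \<Rightarrow> 'v \<Rightarrow> real"
  shows "(\<Sum>i\<in>UNIV. \<Sum>j\<in>neighbours X i. g i j) = (\<Sum>(i, j)\<in>arcs X. g i j)"
proof -
  have "arcs X = Sigma UNIV (neighbours X)"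
    by (auto simp: arcs_def neighbours_def)
  then show ?thesis
    by (simp add: sum.Sigma)
qed

lemma sum_arcs_swap:
  "(\<Sum>(i, j)\<in>arcs X. g i j) = (\<Sum>(i, j)\<in>arcs X. g j i)"
  by (rule sum.reindex_bij_witness[where i = prod.swap and j = prod.swap])
    (auto simp: arcs_def insert_commute)

text \<open>
  Summation by parts on a graph: reversing every arc and averaging.
\<close>

lemma sum_arcs_skew:
  fixes h :: "'v \<Rightarrow> 'v \<Rightarrow> real"
  assumes "\<And>i j. {i, j} \<in> edges X \<Longrightarrow> h j i = - h i j"
  shows "(\<Sum>(i, j)\<in>arcs X. x i * h i j) = (\<Sum>(i, j)\<in>arcs X. (x i - x j) * h i j) / 2"
proof -
  have "(\<Sum>(i, j)\<in>arcs X. x i * h i j) = (\<Sum>(i, j)\<in>arcs X. x j * h j i)"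
    by (rule sum_arcs_swap)
  also have "\<dots> = (\<Sum>(i, j)\<in>arcs X. - (x j * h i j))"
  proof (rule sum.cong[OF refl], clarify)
    fix i j
    assume "(i, j) \<in> arcs X"
    then have "h j i = - h i j" by (intro assms) (simp add: arcs_def)
    then show "x j * h j i = - (x j * h i j)" by (simp only: mult_minus_right)
  qed
  also have "\<dots> = - (\<Sum>(i, j)\<in>arcs X. x j * h i j)"
    by (simp add: sum_negf case_prod_unfold)
  finally have "(\<Sum>(i, j)\<in>arcs X. x j * h i j) = - (\<Sum>(i, j)\<in>arcs X. x i * h i j)"
    by linarith
  moreover have "(\<Sum>(i, j)\<in>arcs X. (x i - x j) * h i j)
      = (\<Sum>(i, j)\<in>arcs X. x i * h i j) - (\<Sum>(i, j)\<in>arcs X. x j * h i j)"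
    by (simp add: sum_subtractf[symmetric] left_diff_distrib case_prod_unfold)
  ultimately show ?thesis by linarith
qed

lemma sum_arcs_eq_sum_edges:
  fixes X :: "'v::finite wgraph" and g :: "'v \<Rightarrow> 'v \<Rightarrow> real"
  assumes X: "weighted_graph X" and G: "\<And>i j. {i, j} \<in> edges X \<Longrightarrow> G {i, j} = g i j"
  shows "(\<Sum>(i, j)\<in>arcs X. g i j) = 2 * (\<Sum>e\<in>edges X. G e)"
proof -
  let ?h = "\<lambda>(i, j). {i, j}"
  have "(\<Sum>(i, j)\<in>arcs X. g i j) = (\<Sum>e\<in>edges X. \<Sum>(i, j)\<in>{p \<in> arcs X. ?h p = e}. g i j)"
    by (rule sum.group[symmetric]) (auto simp: arcs_def)
  also have "\<dots> = (\<Sum>e\<in>edges X. 2 * G e)"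
  proof (rule sum.cong[OF refl])
    fix e
    assume e: "e \<in> edges X"
    then obtain i j where ij: "i \<noteq> j" "e = {i, j}"
      using X[unfolded weighted_graph_def, THEN conjunct1] by blast
    have edge: "{i, j} \<in> edges X" "{j, i} \<in> edges X" "{j, i} = e"
      using e ij(2) by (simp_all only: insert_commute[of j i])
    have fibre: "{p \<in> arcs X. ?h p = e} = {(i, j), (j, i)}"
    proof (rule set_eqI)
      fix p :: "'v \<times> 'v"
      obtain a b where p: "p = (a, b)" by (cases p)
      have "{a, b} = e \<longleftrightarrow> a = i \<and> b = j \<or> a = j \<and> b = i"
        unfolding ij(2) by (rule doubleton_eq_iff)
      then show "p \<in> {p \<in> arcs X. ?h p = e} \<longleftrightarrow> p \<in> {(i, j), (j, i)}"
        using e by (simp add: p arcs_def) blast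
    qed
    have "(\<Sum>(i, j)\<in>{p \<in> arcs X. ?h p = e}. g i j) = g i j + g j i"
      unfolding fibre using ij(1) by simp
    also have "\<dots> = 2 * G e"
      using G[OF edge(1)] G[OF edge(2)] unfolding edge(3) ij(2)[symmetric] by simp
    finally show "(\<Sum>(i, j)\<in>{p \<in> arcs X. ?h p = e}. g i j) = 2 * G e" .
  qed
  finally show ?thesis by (simp add: sum_distrib_left)
qed

lemma inner_laplacian:
  assumes "weighted_graph X"
  shows "x \<bullet> (laplacian X *v y) =
    (\<Sum>(i, j)\<in>arcs X. weight X i j * ((x $ i - x $ j) * (y $ i - y $ j))) / 2"
proof -
  have "x \<bullet> (laplacian X *v y) = (\<Sum>(i, j)\<in>arcs X. x $ i * (weight X i j * (y $ i - y $ j)))"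
    by (simp add: inner_vec_def laplacian_mult_vec sum_distrib_left sum_neighbours_eq_sum_arcs)
  also have "\<dots> = (\<Sum>(i, j)\<in>arcs X. (x $ i - x $ j) * (weight X i j * (y $ i - y $ j))) / 2"
    by (rule sum_arcs_skew) (simp add: weight_commute[OF assms] algebra_simps)
  finally show ?thesis by (simp add: mult_ac)
qed

lemma laplacian_symmetric:
  assumes "weighted_graph X"
  shows "x \<bullet> (laplacian X *v y) = (laplacian X *v x) \<bullet> y"
  unfolding inner_commute[of "laplacian X *v x"] inner_laplacian[OF assms] by (simp add: mult_ac)

lemma laplacian_const: "laplacian X *v vec c = 0"
  by (simp add: vec_eq_iff laplacian_mult_vec)

lemma laplacian_form_nonneg:
  assumes "weighted_graph X"
  shows "x \<bullet> (laplacian X *v x) \<ge> 0"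
  unfolding inner_laplacian[OF assms]
  by (rule divide_nonneg_nonneg[OF sum_nonneg])
    (auto simp: arcs_def intro!: mult_nonneg_nonneg[OF less_imp_le[OF weight_pos[OF assms]] zero_le_square])

text \<open>
  The form is a sum of squares over the edges with positive weights, so \<open>x\<close> agrees along every edge
  and hence along every path.
\<close>

lemma laplacian_form_eq_0:
  fixes X :: "'n::finite wgraph"
  assumes X: "weighted_graph X" and conn: "connected_graph X"
    and zero: "x \<bullet> (laplacian X *v x) = 0"
  shows "x $ i = x $ j"
proof -
  have "(\<Sum>(i, j)\<in>arcs X. weight X i j * ((x $ i - x $ j) * (x $ i - x $ j))) = 0"
    using zero inner_laplacian[OF X, of x x] by simp
  moreover have "weight X i j * ((x $ i - x $ j) * (x $ i - x $ j)) \<ge> 0" if "(i, j) \<in> arcs X" for i j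
    by (rule mult_nonneg_nonneg[OF less_imp_le[OF weight_pos[OF X]] zero_le_square])
      (use that in \<open>simp add: arcs_def\<close>)
  ultimately have zero_arcs: "\<forall>p\<in>arcs X. (case p of (i, j) \<Rightarrow> weight X i j * ((x $ i - x $ j) * (x $ i - x $ j))) = 0"
    by (subst (asm) sum_nonneg_eq_0_iff) auto
  have adjacent: "x $ u = x $ v" if "v \<in> neighbours X u" for u v
  proof -
    have uv: "{u, v} \<in> edges X" using that by (simp add: neighbours_def)
    then have "weight X u v * ((x $ u - x $ v) * (x $ u - x $ v)) = 0"
      using bspec[OF zero_arcs, of "(u, v)"] by (simp add: arcs_def)
    then show ?thesis using weight_pos[OF X uv] by simp
  qed
  have "(\<lambda>u v. v \<in> neighbours X u)\<^sup>*\<^sup>* i j"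
    using conn by (simp add: connected_graph_def)
  then show ?thesis
  proof (induction rule: rtranclp_induct)
    case (step u v)
    then show ?case using adjacent[of v u] by simp
  qed simp
qed

text \<open>
  Eigenvectors for different eigenvalues of a symmetric matrix are orthogonal, hence independent.
  This ensures that the minimum in \<open>lambda2\<close> ranges over a finite set.
\<close>

lemma finite_eigenvalues_symmetric:
  fixes A :: "real^'n^'n"
  assumes sym: "\<And>x y. x \<bullet> (A *v y) = (A *v x) \<bullet> y"
  shows "finite {\<mu>. eigenvalue A \<mu>}"
proof -
  define v where "v \<mu> = (SOME v. v \<noteq> 0 \<and> A *v v = \<mu> *\<^sub>R v)" for \<mu>
  have v: "v \<mu> \<noteq> 0 \<and> A *v v \<mu> = \<mu> *\<^sub>R v \<mu>" if "eigenvalue A \<mu>" for \<mu>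
    using that unfolding eigenvalue_def v_def by (rule someI_ex)
  have orth: "v \<mu> \<bullet> v \<nu> = 0" if "eigenvalue A \<mu>" "eigenvalue A \<nu>" "\<mu> \<noteq> \<nu>" for \<mu> \<nu>
  proof -
    have "\<mu> * (v \<mu> \<bullet> v \<nu>) = \<nu> * (v \<mu> \<bullet> v \<nu>)"
      using sym[of "v \<mu>" "v \<nu>"] v that by simp
    then show ?thesis using that(3) by simp
  qed
  have "inj_on v {\<mu>. eigenvalue A \<mu>}"
  proof (rule inj_onI, rule ccontr)
    fix \<mu> \<nu>
    assume "\<mu> \<in> {\<mu>. eigenvalue A \<mu>}" "\<nu> \<in> {\<mu>. eigenvalue A \<mu>}" "v \<mu> = v \<nu>" "\<mu> \<noteq> \<nu>"
    then show False using orth[of \<mu> \<nu>] v[of \<nu>] by simp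
  qed
  moreover have "independent (v ` {\<mu>. eigenvalue A \<mu>})"
    by (rule pairwise_orthogonal_independent)
      (use orth v in \<open>auto simp: pairwise_def orthogonal_def\<close>)
  then have "finite (v ` {\<mu>. eigenvalue A \<mu>})"
    using independent_bound by blast
  ultimately show ?thesis
    using finite_image_iff by blast
qed

lemma linear_term_of_nonneg_quadratic:
  fixes b c :: real
  assumes "\<And>t. 2 * t * b + t\<^sup>2 * c \<ge> 0"
  shows "b = 0"
proof (rule ccontr)
  assume "b \<noteq> 0"
  have "c \<ge> 0" using assms[of 1] assms[of "-1"] by simp
  define s where "s = b / (c + 1)"
  have b: "b = s * (c + 1)" using \<open>c \<ge> 0\<close> by (simp add: s_def)
  then have "s \<noteq> 0" using \<open>b \<noteq> 0\<close> by auto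
  have "2 * (- s) * b + (- s)\<^sup>2 * c = - (s\<^sup>2 * (c + 2))"
    unfolding b by (simp add: algebra_simps power2_eq_square)
  also have "\<dots> < 0"
    using \<open>c \<ge> 0\<close> \<open>s \<noteq> 0\<close> by simp
  finally show False using assms[of "- s"] by simp
qed

text \<open>
  On the compact set of unit vectors orthogonal to the constants the form attains its minimum \<open>\<mu>\<close>,
  at some \<open>v\<close>. The residual \<open>u = laplacian X *v v - \<mu> *\<^sub>R v\<close> is again orthogonal to the constants,
  so that \<open>v + t *\<^sub>R u\<close> is an admissible variation, and minimality forces \<open>u = 0\<close>.
\<close>

lemma rayleigh_minimum_eigenvalue:
  fixes X :: "'n::finite wgraph"
  assumes X: "weighted_graph X" and conn: "connected_graph X" and card: "CARD('n) \<ge> 2"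
  obtains \<mu> where "\<mu> > 0" "eigenvalue (laplacian X) \<mu>"
    "\<And>x. 1 \<bullet> x = 0 \<Longrightarrow> \<mu> * (x \<bullet> x) \<le> x \<bullet> (laplacian X *v x)"
proof -
  let ?L = "laplacian X"
  define K where "K = {x :: real^'n. 1 \<bullet> x = 0} \<inter> sphere 0 1"
  have "compact K"
    unfolding K_def by (intro closed_Int_compact closed_hyperplane compact_sphere)
  moreover have "K \<noteq> {}"
  proof -
    have "\<not> CARD('n) \<le> Suc 0" using card by simp
    then obtain i j :: 'n where "i \<noteq> j"
      unfolding card_le_Suc0_iff_eq[OF finite] by blast
    define u :: "real^'n" where "u = axis i 1 - axis j 1"
    have "u $ i = 1" using \<open>i \<noteq> j\<close> by (simp add: u_def axis_def)
    then have "u \<noteq> 0" by auto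
    moreover have "1 \<bullet> u = 0" by (simp add: u_def inner_diff_right inner_axis)
    ultimately have "(1 / norm u) *\<^sub>R u \<in> K"
      unfolding K_def by simp
    then show ?thesis by blast
  qed
  moreover have "continuous_on K (\<lambda>x. x \<bullet> (?L *v x))"
    by (intro continuous_on_inner continuous_on_id matrix_vector_mult_linear_continuous_on)
  ultimately have "\<exists>v\<in>K. \<forall>y\<in>K. v \<bullet> (?L *v v) \<le> y \<bullet> (?L *v y)"
    by (rule continuous_attains_inf)
  then obtain v where v: "v \<in> K" "\<And>y. y \<in> K \<Longrightarrow> v \<bullet> (?L *v v) \<le> y \<bullet> (?L *v y)"
    by blast
  have v': "1 \<bullet> v = 0" "v \<bullet> v = 1"
    using v(1) by (auto simp: K_def norm_eq_1)
  define \<mu> where "\<mu> = v \<bullet> (?L *v v)"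
  have rayleigh: "\<mu> * (x \<bullet> x) \<le> x \<bullet> (?L *v x)" if x: "1 \<bullet> x = 0" for x
  proof (cases "x = 0")
    case False
    define y where "y = (1 / norm x) *\<^sub>R x"
    have "y \<in> K" using False x by (simp add: K_def y_def)
    then have "\<mu> \<le> y \<bullet> (?L *v y)" using v(2) by (simp add: \<mu>_def)
    also have "y \<bullet> (?L *v y) = (x \<bullet> (?L *v x)) / (x \<bullet> x)"
      by (simp add: y_def matrix_vector_mult_scaleR norm_eq_sqrt_inner)
    finally show ?thesis
      using False by (simp add: pos_le_divide_eq)
  qed simp
  define u where "u = ?L *v v - \<mu> *\<^sub>R v"
  have "1 \<bullet> (?L *v v) = 0"
    unfolding laplacian_symmetric[OF X] using laplacian_const[of X 1] by simp
  then have u1: "1 \<bullet> u = 0"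
    using v'(1) by (simp add: u_def inner_diff_right)
  have "2 * t * (u \<bullet> u) + t\<^sup>2 * (u \<bullet> (?L *v u) - \<mu> * (u \<bullet> u)) \<ge> 0" for t
  proof -
    have "1 \<bullet> (v + t *\<^sub>R u) = 0" using u1 v'(1) by (simp add: inner_add_right)
    from rayleigh[OF this]
    have "0 \<le> (v + t *\<^sub>R u) \<bullet> (?L *v (v + t *\<^sub>R u)) - \<mu> * ((v + t *\<^sub>R u) \<bullet> (v + t *\<^sub>R u))"
      by simp
    also have "(v + t *\<^sub>R u) \<bullet> (?L *v (v + t *\<^sub>R u)) = \<mu> + 2 * t * (u \<bullet> (?L *v v)) + t\<^sup>2 * (u \<bullet> (?L *v u))"
      using laplacian_symmetric[OF X, of v u]
      by (simp add: matrix_vector_right_distrib matrix_vector_mult_scaleR inner_add_left inner_add_right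
          \<mu>_def[symmetric] inner_commute[of "?L *v v" u] power2_eq_square distrib_left mult.assoc)
    also have "(v + t *\<^sub>R u) \<bullet> (v + t *\<^sub>R u) = 1 + 2 * t * (u \<bullet> v) + t\<^sup>2 * (u \<bullet> u)"
      using v'(2) by (simp add: inner_add_left inner_add_right inner_commute[of v u] power2_eq_square distrib_left mult.assoc)
    also have "u \<bullet> (?L *v v) = u \<bullet> u + \<mu> * (u \<bullet> v)"
    proof -
      have "?L *v v = u + \<mu> *\<^sub>R v" by (simp add: u_def)
      then show ?thesis by (simp add: inner_add_right)
    qed
    finally have "0 \<le> \<mu> + 2 * t * (u \<bullet> u + \<mu> * (u \<bullet> v)) + t\<^sup>2 * (u \<bullet> (?L *v u))
        - \<mu> * (1 + 2 * t * (u \<bullet> v) + t\<^sup>2 * (u \<bullet> u))" .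
    then show ?thesis by (simp add: algebra_simps)
  qed
  then have "u \<bullet> u = 0" by (rule linear_term_of_nonneg_quadratic)
  then have eig: "?L *v v = \<mu> *\<^sub>R v" by (simp add: u_def)
  have "\<mu> \<noteq> 0"
  proof
    assume "\<mu> = 0"
    then have const: "v $ i = v $ j" for i j
      using laplacian_form_eq_0[OF X conn, of v] by (simp add: \<mu>_def)
    have "v $ i = 0" for i
    proof -
      have "1 \<bullet> v = sum (($) v) UNIV" by (simp add: inner_vec_def)
      also have "\<dots> = (\<Sum>j\<in>(UNIV :: 'n set). v $ i)" by (rule sum.cong[OF refl const])
      finally show ?thesis using v'(1) by simp
    qed
    then have "v = 0" by (simp add: vec_eq_iff)
    then show False using v'(2) by simp
  qed
  moreover have "\<mu> \<ge> 0" unfolding \<mu>_def by (rule laplacian_form_nonneg[OF X])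
  moreover have "v \<noteq> 0" using v'(2) by auto
  then have "eigenvalue ?L \<mu>" using eig by (auto simp: eigenvalue_def)
  ultimately show thesis using that[of \<mu>] rayleigh by simp
qed

text \<open>
  The minimum of the Rayleigh quotient is one of the nonzero eigenvalues, so the least of these
  is no larger.
\<close>

lemma
  fixes X :: "'n::finite wgraph"
  assumes X: "weighted_graph X" and conn: "connected_graph X" and card: "CARD('n) \<ge> 2"
  shows lambda2_laplacian_pos: "lambda2 (laplacian X) > 0"
    and lambda2_laplacian_le: "1 \<bullet> x = 0 \<Longrightarrow> lambda2 (laplacian X) * (x \<bullet> x) \<le> x \<bullet> (laplacian X *v x)"
proof -
  let ?L = "laplacian X"
  let ?E = "{\<mu>. eigenvalue ?L \<mu> \<and> \<mu> \<noteq> 0}"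
  obtain \<mu> where \<mu>: "\<mu> > 0" "eigenvalue ?L \<mu>" "\<And>x. 1 \<bullet> x = 0 \<Longrightarrow> \<mu> * (x \<bullet> x) \<le> x \<bullet> (?L *v x)"
    using rayleigh_minimum_eigenvalue[OF assms] by blast
  have fin: "finite ?E"
    using finite_eigenvalues_symmetric[OF laplacian_symmetric[OF X]] by simp
  have \<mu>E: "\<mu> \<in> ?E" using \<mu> by simp
  have "lambda2 ?L \<in> ?E" unfolding lambda2_def using fin \<mu>E by (intro Min_in) auto
  then obtain w where w: "w \<noteq> 0" "?L *v w = lambda2 ?L *\<^sub>R w" and ne: "lambda2 ?L \<noteq> 0"
    by (auto simp: eigenvalue_def)
  have "lambda2 ?L * (w \<bullet> w) \<ge> 0" using laplacian_form_nonneg[OF X, of w] w(2) by simp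
  moreover have "w \<bullet> w > 0" using w(1) by simp
  ultimately have "lambda2 ?L \<ge> 0" by (simp add: zero_le_mult_iff)
  then show "lambda2 ?L > 0" using ne by simp
  have "lambda2 ?L \<le> \<mu>" unfolding lambda2_def using fin \<mu>E by (rule Min_le)
  then show "lambda2 ?L * (x \<bullet> x) \<le> x \<bullet> (?L *v x)" if "1 \<bullet> x = 0"
    using \<mu>(3)[OF that] by (meson inner_ge_zero mult_right_mono order_trans)
qed

definition deviation :: "real^'n \<Rightarrow> real^'n" where
  "deviation x = x - ((1 \<bullet> x) / CARD('n)) *\<^sub>R 1"

lemma linear_deviation: "linear deviation"
  by (rule linearI)
    (simp_all add: deviation_def inner_add_right add_divide_distrib algebra_simps)

lemma inner_1_deviation: "1 \<bullet> deviation x = 0"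
  by (simp add: deviation_def inner_diff_right inner_vec_def sum_subtractf)

lemma deviation_eq_self: "1 \<bullet> y = 0 \<Longrightarrow> deviation y = y"
  by (simp add: deviation_def)

lemma inner_deviation: "1 \<bullet> y = 0 \<Longrightarrow> deviation x \<bullet> y = x \<bullet> y"
  by (simp add: deviation_def inner_diff_left)

lemma deviation_eq_0_imp_const:
  assumes "deviation x = 0"
  shows "x $ i = x $ j"
proof -
  have "deviation x $ i = 0" "deviation x $ j = 0" using assms by simp_all
  then show ?thesis by (simp add: deviation_def)
qed

lemma laplacian_deviation: "laplacian X *v deviation x = laplacian X *v x"
  using laplacian_const[of X 1]
  by (simp add: deviation_def matrix_vector_mult_diff_distrib matrix_vector_mult_scaleR)

lemma inner_1_laplacian:
  assumes "weighted_graph X"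
  shows "1 \<bullet> (laplacian X *v x) = 0"
  unfolding laplacian_symmetric[OF assms] using laplacian_const[of X 1] by simp

lemma lambda2_deviation_le:
  fixes X :: "'n::finite wgraph"
  assumes X: "weighted_graph X" and "connected_graph X" "CARD('n) \<ge> 2"
  shows "lambda2 (laplacian X) * (norm (deviation x))\<^sup>2 \<le> x \<bullet> (laplacian X *v x)"
  using lambda2_laplacian_le[OF assms inner_1_deviation, of x]
  by (simp add: laplacian_deviation inner_deviation inner_1_laplacian[OF X] power2_norm_eq_inner)

text \<open>
  With \<open>y\<close> the deviation of \<open>x\<close> and \<open>w\<close> its image under the Laplacian, Cauchy--Schwarz for
  \<open>y \<bullet> w\<close> combines with the lower bound of the form on \<open>y\<close>.
\<close>

lemma lambda2_form_le:
  fixes X :: "'n::finite wgraph"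
  assumes X: "weighted_graph X" and conn: "connected_graph X" and card: "CARD('n) \<ge> 2"
  shows "lambda2 (laplacian X) * (x \<bullet> (laplacian X *v x)) \<le> (norm (laplacian X *v x))\<^sup>2"
proof -
  let ?w = "laplacian X *v x" and ?y = "deviation x" and ?l = "lambda2 (laplacian X)"
  define q where "q = x \<bullet> ?w"
  have q: "q = ?y \<bullet> ?w"
    by (simp add: q_def inner_deviation inner_1_laplacian[OF X])
  have "?l > 0" by (rule lambda2_laplacian_pos[OF assms])
  have "q \<ge> 0" unfolding q_def by (rule laplacian_form_nonneg[OF X])
  have "?l * q * q \<le> ?l * ((?y \<bullet> ?y) * (?w \<bullet> ?w))"
    using Cauchy_Schwarz_ineq[of ?y ?w] \<open>?l > 0\<close> q by (simp add: power2_eq_square)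
  also have "\<dots> = (?l * (norm ?y)\<^sup>2) * (norm ?w)\<^sup>2"
    by (simp add: power2_norm_eq_inner)
  also have "\<dots> \<le> q * (norm ?w)\<^sup>2"
    using lambda2_deviation_le[OF assms, of x] by (intro mult_right_mono) (auto simp: q_def)
  finally have "?l * q * q \<le> (norm ?w)\<^sup>2 * q" by (simp add: mult.commute)
  then show ?thesis
    using \<open>q \<ge> 0\<close> by (cases "q = 0") (auto simp: q_def[symmetric])
qed

section \<open>Consensus functions on finite index sets\<close>

text \<open>
  Scaling all \<open>x a\<close> down by a common factor makes the bound on \<open>y\<close> an equality, and this only
  decreases the right-hand side because \<open>\<Omega>\<close> is monotone.
\<close>

lemma consensus_function_sum_bound:
  assumes \<Omega>: "predefined_time_consensus_function \<Omega> \<Omega>h \<beta> d"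
    and A: "finite A" "card A \<ge> 1" and x: "\<And>a. a \<in> A \<Longrightarrow> x a \<ge> 0"
    and y: "0 \<le> y" "y \<le> \<beta> (card A) * L2_set x A"
  shows "\<Omega>h y \<le> \<beta> (card A) powr d * (\<Sum>a\<in>A. \<Omega> (x a))"
proof -
  define n where "n = card A"
  define m where "m = \<beta> n * L2_set x A"
  define s where "s = y / m"
  have mono: "mono \<Omega>"
    and bound: "\<And>x :: nat \<Rightarrow> real. (\<forall>i\<in>{1..n}. x i \<ge> 0) \<Longrightarrow>
        \<Omega>h (\<beta> n * L2_set x {1..n}) \<le> \<beta> n powr d * (\<Sum>i=1..n. \<Omega> (x i))"
    using \<Omega> A(2) unfolding predefined_time_consensus_function_def n_def by blast+
  have "0 \<le> y" "y \<le> m" using y by (simp_all add: m_def n_def)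
  then have s: "0 \<le> s" "s \<le> 1" "y = s * m"
    by (auto simp: s_def divide_le_eq_1)
  obtain h where h: "bij_betw h {1..n} A"
    using ex_bij_betw_nat_finite_1[OF A(1)] unfolding n_def by blast
  then have hA: "h i \<in> A" if "i \<in> {1..n}" for i
    using that by (auto simp: bij_betw_def)
  have "L2_set (\<lambda>i. s * x (h i)) {1..n} = s * L2_set (\<lambda>i. x (h i)) {1..n}"
    using L2_set_right_distrib[OF s(1)] by metis
  also have "L2_set (\<lambda>i. x (h i)) {1..n} = L2_set x A"
    unfolding L2_set_def using sum.reindex_bij_betw[OF h, of "\<lambda>a. (x a)\<^sup>2"] by simp
  finally have "\<beta> n * L2_set (\<lambda>i. s * x (h i)) {1..n} = y"
    by (simp add: s(3) m_def)
  then have "\<Omega>h y \<le> \<beta> n powr d * (\<Sum>i=1..n. \<Omega> (s * x (h i)))"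
    using bound[of "\<lambda>i. s * x (h i)"] s(1) x hA by auto
  also have "\<dots> \<le> \<beta> n powr d * (\<Sum>i=1..n. \<Omega> (x (h i)))"
    using s x hA mult_left_le_one_le
    by (intro mult_left_mono sum_mono monoD[OF mono]) auto
  also have "(\<Sum>i=1..n. \<Omega> (x (h i))) = (\<Sum>a\<in>A. \<Omega> (x a))"
    by (rule sum.reindex_bij_betw[OF h])
  finally show ?thesis by (simp add: n_def)
qed

section \<open>Displacements\<close>

lemma satisfies_displacement_shift:
  assumes "satisfies_displacement dd p" and "\<And>i j. (z - p) $ i = (z - p) $ j"
  shows "satisfies_displacement dd z"
  unfolding satisfies_displacement_def
proof (intro allI)
  fix i j
  have "p $ j - p $ i = dd j i" using assms(1) by (simp add: satisfies_displacement_def)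
  then show "z $ j - z $ i = dd j i" using assms(2)[of i j] by simp
qed

lemma edge_error_eq:
  assumes "satisfies_displacement dd p"
  shows "edge_error X dd z i j = sqrt (weight X i j) * ((z - p) $ j - (z - p) $ i)"
proof -
  have "dd j i = p $ j - p $ i" using assms by (simp add: satisfies_displacement_def)
  then have "z $ j - z $ i - dd j i = (z - p) $ j - (z - p) $ i" by simp
  then show ?thesis by (simp only: edge_error_def)
qed

lemma node_error_eq:
  assumes "satisfies_displacement dd p"
  shows "node_error X dd z i = - (laplacian X *v (z - p)) $ i"
proof -
  have "dd j i = p $ j - p $ i" for j using assms by (simp add: satisfies_displacement_def)
  then have "z $ j - z $ i - dd j i = - ((z - p) $ i - (z - p) $ j)" for j by simp
  then show ?thesis
    by (simp only: node_error_def laplacian_mult_vec mult_minus_right sum_negf)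
qed

section \<open>Dissipation under the edge rule\<close>

text \<open>
  The defining inequality of a consensus function is applied to the family of edges, each taken
  once, whereas the rules are written with ordered pairs; a symmetric function of ordered pairs descends to the edges.
\<close>

lemma symmetric_edge_function:
  assumes "\<And>i j. {i, j} \<in> edges X \<Longrightarrow> g i j = g j i"
  obtains G where "\<And>i j. {i, j} \<in> edges X \<Longrightarrow> G {i, j} = g i j"
proof
  fix i j
  assume ij: "{i, j} \<in> edges X"
  define P where "P v \<longleftrightarrow> (\<exists>k l. {i, j} = {k, l} \<and> v = g k l)" for v
  have "P (SOME v. P v)" by (rule someI[of P "g i j"]) (auto simp: P_def)
  then have "(SOME v. P v) = g i j \<or> (SOME v. P v) = g j i"
    unfolding P_def doubleton_eq_iff by blast
  then have "(SOME v. P v) = g i j" using assms[OF ij] by presburger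
  then show "(\<lambda>e. SOME v. \<exists>k l. e = {k, l} \<and> v = g k l) {i, j} = g i j"
    by (simp add: P_def)
qed

lemma connected_graph_card_edges:
  fixes X :: "'n::finite wgraph"
  assumes "connected_graph X" and card: "CARD('n) \<ge> 2"
  shows "card (edges X) \<ge> 1"
proof -
  have "\<not> CARD('n) \<le> Suc 0" using card by simp
  then obtain i j :: 'n where "i \<noteq> j"
    unfolding card_le_Suc0_iff_eq[OF finite] by blast
  moreover have "(\<lambda>u v. v \<in> neighbours X u)\<^sup>*\<^sup>* i j"
    using assms(1) by (simp add: connected_graph_def)
  ultimately obtain k where "k \<in> neighbours X i"
    by (metis converse_rtranclpE)
  then have "edges X \<noteq> {}" by (auto simp: neighbours_def)
  then show ?thesis by (simp add: Suc_le_eq card_gt_0_iff)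
qed

text \<open>
  Since the summands of the rule are skew, its components add up to \<open>0\<close>, so the deviation of \<open>u\<close> is \<open>u\<close>
  itself and only \<open>x \<bullet> u\<close> matters, where \<open>x = z - p\<close>. This equals \<open>- \<kappa>\<close> times the sum of \<open>\<Omega>\<close> over the
  absolute edge errors, whose squares add up to the Laplacian form. The map \<open>c *\<^sub>R deviation\<close>
  depends on the bounds \<open>lam\<close> and \<open>m2\<close> but not on the graph, which is what makes it a common
  Lyapunov function under switching.
\<close>

lemma edge_rule_decay:
  fixes X :: "'n::finite wgraph" and z p :: "real^'n"
  assumes \<Omega>: "predefined_time_consensus_function \<Omega> \<Omega>h \<beta> d" and \<Omega>0: "\<Omega> 0 = 0"
    and dd: "satisfies_displacement dd p" and "Tc > 0"
    and X: "weighted_graph X" and conn: "connected_graph X" and card: "CARD('n) \<ge> 2"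
    and lam: "0 < lam" "lam \<le> lambda2 (laplacian X)"
    and m: "1 \<le> m1" "m1 \<le> card (edges X)" "card (edges X) \<le> m2"
    and \<kappa>: "\<kappa> \<ge> \<beta> m1 powr d / (lam * (\<beta> m2)\<^sup>2 * Tc)"
    and c: "c = \<beta> m2 * sqrt lam" and u: "u = edge_rule \<kappa> \<Omega> (\<lambda>_. X) dd t z"
  shows "(c *\<^sub>R deviation (z - p)) \<bullet> (c *\<^sub>R deviation u)
      \<le> - (1 / Tc) * \<Omega>h (norm (c *\<^sub>R deviation (z - p)))"
    and "c *\<^sub>R deviation (z - p) = 0 \<Longrightarrow> u = 0"
    and "c *\<^sub>R deviation (z - p) = 0 \<Longrightarrow> (z - p) $ i = (z - p) $ j"
proof -
  define x where "x = z - p"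
  define e where "e i j = edge_error X dd z i j" for i j
  define h where "h i j = sqrt (weight X i j) * (inverse (e i j) * \<Omega> \<bar>e i j\<bar>)" for i j
  have mono: "mono \<Omega>" and \<beta>pos: "\<And>n. n \<ge> 1 \<Longrightarrow> \<beta> n > 0"
    and \<beta>dec: "\<And>m n. 1 \<le> m \<Longrightarrow> m \<le> n \<Longrightarrow> \<beta> n \<le> \<beta> m" and "d \<ge> 1"
    using \<Omega> unfolding predefined_time_consensus_function_def by blast+
  have e: "e i j = sqrt (weight X i j) * (x $ j - x $ i)" for i j
    unfolding e_def x_def by (rule edge_error_eq[OF dd])
  have e_skew: "e j i = - e i j" if "{i, j} \<in> edges X" for i j
    unfolding e weight_commute[OF X that] by (simp add: algebra_simps)
  have h_skew: "h j i = - h i j" if "{i, j} \<in> edges X" for i j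
    unfolding h_def e_skew[OF that] weight_commute[OF X that] by simp
  have u_nth: "u $ i = \<kappa> * (\<Sum>j\<in>neighbours X i. h i j)" for i
    by (simp add: u edge_rule_def h_def e_def)
  have inner_u: "y \<bullet> u = \<kappa> * ((\<Sum>(i, j)\<in>arcs X. (y $ i - y $ j) * h i j) / 2)" for y
  proof -
    have "y \<bullet> u = \<kappa> * (\<Sum>i\<in>UNIV. \<Sum>j\<in>neighbours X i. y $ i * h i j)"
      by (simp add: inner_vec_def u_nth sum_distrib_left mult_ac)
    also have "(\<Sum>i\<in>UNIV. \<Sum>j\<in>neighbours X i. y $ i * h i j) = (\<Sum>(i, j)\<in>arcs X. y $ i * h i j)"
      by (rule sum_neighbours_eq_sum_arcs)
    also have "\<dots> = (\<Sum>(i, j)\<in>arcs X. (y $ i - y $ j) * h i j) / 2"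
      by (rule sum_arcs_skew[OF h_skew])
    finally show ?thesis .
  qed
  have u1: "1 \<bullet> u = 0"
    using inner_u[of 1] by (simp add: case_prod_unfold)
  obtain \<epsilon> where \<epsilon>: "\<And>i j. {i, j} \<in> edges X \<Longrightarrow> \<epsilon> {i, j} = \<bar>e i j\<bar>"
    using symmetric_edge_function[of X "\<lambda>i j. \<bar>e i j\<bar>"] e_skew by (metis abs_minus_cancel)
  have \<epsilon>_nonneg: "\<epsilon> E \<ge> 0" if E: "E \<in> edges X" for E
  proof -
    obtain i j where "E = {i, j}"
      using X[unfolded weighted_graph_def, THEN conjunct1] E by blast
    then show ?thesis using \<epsilon>[of i j] E by simp
  qed
  define S where "S = (\<Sum>E\<in>edges X. \<Omega> (\<epsilon> E))"
  have "S \<ge> 0"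
    unfolding S_def using \<epsilon>_nonneg monoD[OF mono, of 0] \<Omega>0 by (intro sum_nonneg) auto
  have "(\<Sum>(i, j)\<in>arcs X. (x $ i - x $ j) * h i j) = (\<Sum>(i, j)\<in>arcs X. - \<Omega> \<bar>e i j\<bar>)"
  proof (rule sum.cong[OF refl], clarify)
    fix i j
    \<comment> \<open>For \<open>e i j = 0\<close> this relies on \<open>inverse 0 = 0\<close> and \<open>\<Omega> 0 = 0\<close>.\<close>
    have "(x $ i - x $ j) * h i j = - (e i j * inverse (e i j)) * \<Omega> \<bar>e i j\<bar>"
      unfolding h_def by (subst (2) e) (simp add: algebra_simps)
    also have "\<dots> = - \<Omega> \<bar>e i j\<bar>" using \<Omega>0 by (cases "e i j = 0") auto
    finally show "(x $ i - x $ j) * h i j = - \<Omega> \<bar>e i j\<bar>" .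
  qed
  also have "\<dots> = 2 * (\<Sum>E\<in>edges X. - \<Omega> (\<epsilon> E))"
    by (rule sum_arcs_eq_sum_edges[OF X]) (simp only: \<epsilon>)
  finally have inner_xu: "x \<bullet> u = - \<kappa> * S"
    by (simp add: inner_u S_def sum_negf)
  have "2 * (x \<bullet> (laplacian X *v x)) = (\<Sum>(i, j)\<in>arcs X. (e i j)\<^sup>2)"
    unfolding inner_laplacian[OF X]
    by (simp, rule sum.cong[OF refl])
      (auto simp: arcs_def e power2_eq_square algebra_simps less_imp_le[OF weight_pos[OF X]])
  also have "\<dots> = 2 * (\<Sum>E\<in>edges X. (\<epsilon> E)\<^sup>2)"
    by (rule sum_arcs_eq_sum_edges[OF X]) (simp only: \<epsilon> power2_abs)
  finally have L2: "L2_set \<epsilon> (edges X) = sqrt (x \<bullet> (laplacian X *v x))"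
    by (simp add: L2_set_def)
  have \<beta>: "0 < \<beta> m2" "\<beta> m2 \<le> \<beta> (card (edges X))" "0 < \<beta> (card (edges X))"
      "\<beta> (card (edges X)) \<le> \<beta> m1"
    using m \<beta>pos \<beta>dec by auto
  then have "c > 0" using lam(1) by (simp add: c)
  define y where "y = norm (c *\<^sub>R deviation x)"
  have "sqrt lam * norm (deviation x) \<le> sqrt (x \<bullet> (laplacian X *v x))"
  proof (rule real_le_rsqrt)
    have "(sqrt lam * norm (deviation x))\<^sup>2 = lam * (norm (deviation x))\<^sup>2"
      using lam(1) by (simp add: power_mult_distrib)
    also have "\<dots> \<le> lambda2 (laplacian X) * (norm (deviation x))\<^sup>2"
      using lam(2) by (rule mult_right_mono) simp
    also have "\<dots> \<le> x \<bullet> (laplacian X *v x)"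
      by (rule lambda2_deviation_le[OF X conn card])
    finally show "(sqrt lam * norm (deviation x))\<^sup>2 \<le> x \<bullet> (laplacian X *v x)" .
  qed
  then have "\<beta> m2 * (sqrt lam * norm (deviation x)) \<le> \<beta> (card (edges X)) * L2_set \<epsilon> (edges X)"
    unfolding L2 using \<beta> lam(1) by (intro mult_mono) auto
  then have "y \<le> \<beta> (card (edges X)) * L2_set \<epsilon> (edges X)"
    using \<open>c > 0\<close> by (simp add: y_def c mult.assoc)
  then have "\<Omega>h y \<le> \<beta> (card (edges X)) powr d * S"
    unfolding S_def using m(1,2) \<epsilon>_nonneg
    by (intro consensus_function_sum_bound[OF \<Omega>]) (auto simp: y_def)
  also have "\<dots> \<le> \<beta> m1 powr d * S"
    using \<beta> \<open>d \<ge> 1\<close> \<open>S \<ge> 0\<close> by (intro mult_right_mono powr_mono2) auto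
  also have "\<dots> \<le> Tc * (c\<^sup>2 * \<kappa>) * S"
  proof (rule mult_right_mono[OF _ \<open>S \<ge> 0\<close>])
    have "c\<^sup>2 = lam * (\<beta> m2)\<^sup>2" using lam(1) by (simp add: c power_mult_distrib)
    moreover have "lam * (\<beta> m2)\<^sup>2 * Tc > 0" using lam(1) \<beta>(1) \<open>Tc > 0\<close> by simp
    ultimately show "\<beta> m1 powr d \<le> Tc * (c\<^sup>2 * \<kappa>)"
      using \<kappa> by (simp add: pos_divide_le_eq mult_ac)
  qed
  finally have "\<Omega>h y / Tc \<le> c\<^sup>2 * \<kappa> * S"
    using \<open>Tc > 0\<close> by (simp add: pos_divide_le_eq mult_ac)
  moreover have "(c *\<^sub>R deviation x) \<bullet> (c *\<^sub>R deviation u) = - (c\<^sup>2 * \<kappa> * S)"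
    using inner_xu by (simp add: deviation_eq_self[OF u1] inner_deviation[OF u1] power2_eq_square)
  ultimately show "(c *\<^sub>R deviation (z - p)) \<bullet> (c *\<^sub>R deviation u)
      \<le> - (1 / Tc) * \<Omega>h (norm (c *\<^sub>R deviation (z - p)))"
    by (simp add: x_def y_def)
  have const: "x $ i = x $ j" if "c *\<^sub>R deviation (z - p) = 0" for i j
    using that \<open>c > 0\<close> by (intro deviation_eq_0_imp_const) (simp add: x_def)
  then show "(z - p) $ i = (z - p) $ j" if "c *\<^sub>R deviation (z - p) = 0"
    using that by (simp only: x_def)
  show "u = 0" if "c *\<^sub>R deviation (z - p) = 0"
  proof -
    have "e i j = 0" for i j
      using const[OF that, of j i] by (simp add: e)
    then show ?thesis by (simp add: vec_eq_iff u_nth h_def)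
  qed
qed

section \<open>Dissipation under the node rule\<close>

text \<open>
  The factor \<open>1 / 2\<close> under the root compensates for both orientations of an edge, so that the inner
  product of two images is exactly the Laplacian form.
\<close>

definition incidence_map :: "'n::finite wgraph \<Rightarrow> real^'n \<Rightarrow> real^'n^'n" where
  "incidence_map X x =
     (\<chi> i j. if {i, j} \<in> edges X then sqrt (weight X i j / 2) * (x $ i - x $ j) else 0)"

lemma linear_incidence_map: "linear (incidence_map X)"
  by (rule linearI) (auto simp: incidence_map_def vec_eq_iff algebra_simps)

lemma inner_incidence_map:
  assumes X: "weighted_graph X"
  shows "incidence_map X x \<bullet> incidence_map X y = x \<bullet> (laplacian X *v y)"
proof -
  have "incidence_map X x \<bullet> incidence_map X y
      = (\<Sum>i\<in>UNIV. \<Sum>j\<in>neighbours X i. weight X i j / 2 * ((x $ i - x $ j) * (y $ i - y $ j)))"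
    unfolding inner_vec_def[where 'b = 'a and 'a = "real^'a"] inner_vec_def[where 'b = 'a and 'a = real]
  proof (rule sum.cong[OF refl], rule sum.mono_neutral_cong_right)
    fix i j
    assume "j \<in> neighbours X i"
    then have ij: "{i, j} \<in> edges X" by (simp add: neighbours_def)
    then have "sqrt (weight X i j / 2) * sqrt (weight X i j / 2) = weight X i j / 2"
      using weight_pos[OF X ij] by simp
    then show "incidence_map X x $ i $ j \<bullet> incidence_map X y $ i $ j
        = weight X i j / 2 * ((x $ i - x $ j) * (y $ i - y $ j))"
      using ij by (simp add: incidence_map_def mult_ac)
  qed (auto simp: neighbours_def incidence_map_def)
  also have "\<dots> = x \<bullet> (laplacian X *v y)"
    unfolding inner_laplacian[OF X] sum_neighbours_eq_sum_arcs
    by (simp add: sum_divide_distrib case_prod_unfold)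
  finally show ?thesis .
qed

text \<open>
  The node errors are the components of \<open>- laplacian X *v x\<close> with \<open>x = z - p\<close>, so that
  \<open>(laplacian X *v x) \<bullet> u\<close> is \<open>- \<kappa>\<close> times the sum of \<open>\<Omega>\<close> over the absolute node errors. Here the
  components of \<open>u\<close> do not add up to \<open>0\<close> in general; the Laplacian form takes the place of the deviation
  from the mean as Lyapunov function.
\<close>

lemma node_rule_decay:
  fixes X :: "'n::finite wgraph" and z p :: "real^'n"
  assumes \<Omega>: "predefined_time_consensus_function \<Omega> \<Omega>h \<beta> d" and \<Omega>0: "\<Omega> 0 = 0"
    and dd: "satisfies_displacement dd p" and "Tc > 0"
    and X: "weighted_graph X" and conn: "connected_graph X" and card: "CARD('n) \<ge> 2"
    and \<kappa>: "\<kappa> \<ge> 1 / (lambda2 (laplacian X) * \<beta> CARD('n) powr (2 - d) * Tc)"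
    and c: "c = \<beta> CARD('n) * sqrt (lambda2 (laplacian X))" and u: "u = node_rule \<kappa> \<Omega> X dd t z"
  shows "(c *\<^sub>R incidence_map X (z - p)) \<bullet> (c *\<^sub>R incidence_map X u)
      \<le> - (1 / Tc) * \<Omega>h (norm (c *\<^sub>R incidence_map X (z - p)))"
    and "c *\<^sub>R incidence_map X (z - p) = 0 \<Longrightarrow> u = 0"
    and "c *\<^sub>R incidence_map X (z - p) = 0 \<Longrightarrow> (z - p) $ i = (z - p) $ j"
proof -
  define x where "x = z - p"
  define w where "w = laplacian X *v x"
  define b where "b = \<beta> CARD('n)"
  define lam where "lam = lambda2 (laplacian X)"
  have mono: "mono \<Omega>" and "b > 0"
    using \<Omega> unfolding predefined_time_consensus_function_def b_def by auto
  have "lam > 0" unfolding lam_def by (rule lambda2_laplacian_pos[OF X conn card])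
  then have "c > 0" using \<open>b > 0\<close> by (simp add: c b_def lam_def)
  have u_nth: "u $ i = - (\<kappa> * (inverse (w $ i) * \<Omega> \<bar>w $ i\<bar>))" for i
    by (simp add: u node_rule_def node_error_eq[OF dd] w_def x_def)
  define S where "S = (\<Sum>i\<in>UNIV. \<Omega> \<bar>w $ i\<bar>)"
  have "S \<ge> 0"
    unfolding S_def using monoD[OF mono, of 0] \<Omega>0 by (intro sum_nonneg) auto
  have "w $ i * u $ i = - (\<kappa> * \<Omega> \<bar>w $ i\<bar>)" for i
    using \<Omega>0 by (cases "w $ i = 0") (auto simp: u_nth)
  then have "w \<bullet> u = - (\<kappa> * S)"
    by (simp add: inner_vec_def S_def sum_distrib_left sum_negf)
  then have inner_u: "x \<bullet> (laplacian X *v u) = - (\<kappa> * S)"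
    using laplacian_symmetric[OF X, of x u] by (simp add: w_def)
  define y where "y = norm (c *\<^sub>R incidence_map X x)"
  have "y = c * norm (incidence_map X x)"
    using \<open>c > 0\<close> by (simp add: y_def)
  also have "norm (incidence_map X x) = sqrt (x \<bullet> w)"
    by (simp add: norm_eq_sqrt_inner inner_incidence_map[OF X] w_def)
  also have "c * sqrt (x \<bullet> w) = b * sqrt (lam * (x \<bullet> w))"
    by (simp add: c b_def lam_def real_sqrt_mult)
  also have "sqrt (lam * (x \<bullet> w)) \<le> sqrt ((norm w)\<^sup>2)"
    unfolding lam_def w_def by (intro real_sqrt_le_mono lambda2_form_le[OF X conn card])
  finally have "y \<le> b * norm w" using \<open>b > 0\<close> by simp
  also have "norm w = L2_set (\<lambda>i. \<bar>w $ i\<bar>) UNIV"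
    by (simp add: norm_vec_def)
  finally have "\<Omega>h y \<le> b powr d * S"
    unfolding S_def b_def using card
    by (intro consensus_function_sum_bound[OF \<Omega>]) (auto simp: y_def)
  also have "\<dots> \<le> Tc * (c\<^sup>2 * \<kappa>) * S"
  proof (rule mult_right_mono[OF _ \<open>S \<ge> 0\<close>])
    \<comment> \<open>This is where the exponent \<open>2 - d\<close> in the bound on \<open>\<kappa>\<close> comes from.\<close>
    have c2: "c\<^sup>2 = lam * (b powr (2 - d) * b powr d)"
      using \<open>lam > 0\<close> \<open>b > 0\<close>
      by (simp add: c b_def lam_def power_mult_distrib powr_add[symmetric])
    have "1 \<le> \<kappa> * (lam * b powr (2 - d) * Tc)"
      using \<kappa> \<open>lam > 0\<close> \<open>b > 0\<close> \<open>Tc > 0\<close> by (simp add: pos_divide_le_eq b_def lam_def)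
    then have "b powr d * 1 \<le> b powr d * (\<kappa> * (lam * b powr (2 - d) * Tc))"
      by (rule mult_left_mono) simp
    then show "b powr d \<le> Tc * (c\<^sup>2 * \<kappa>)" by (simp add: c2 mult_ac)
  qed
  finally have "\<Omega>h y / Tc \<le> c\<^sup>2 * \<kappa> * S"
    using \<open>Tc > 0\<close> by (simp add: pos_divide_le_eq mult_ac)
  then show "(c *\<^sub>R incidence_map X (z - p)) \<bullet> (c *\<^sub>R incidence_map X u)
      \<le> - (1 / Tc) * \<Omega>h (norm (c *\<^sub>R incidence_map X (z - p)))"
    using inner_u
    by (simp add: inner_incidence_map[OF X] x_def[symmetric] y_def power2_eq_square mult_ac)
  have const: "x $ i = x $ j" if "c *\<^sub>R incidence_map X (z - p) = 0" for i j
  proof (rule laplacian_form_eq_0[OF X conn])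
    have "incidence_map X x = 0" using that \<open>c > 0\<close> by (simp add: x_def)
    then show "x \<bullet> (laplacian X *v x) = 0"
      using inner_incidence_map[OF X, of x x] by simp
  qed
  then show "(z - p) $ i = (z - p) $ j" if "c *\<^sub>R incidence_map X (z - p) = 0"
    using that by (simp only: x_def)
  show "u = 0" if "c *\<^sub>R incidence_map X (z - p) = 0"
  proof -
    have "w $ i = 0" for i
      unfolding w_def laplacian_mult_vec
    proof (rule sum.neutral, rule ballI)
      fix j
      show "weight X i j * (x $ i - x $ j) = 0" using const[OF that, of i j] by simp
    qed
    then show ?thesis by (simp add: vec_eq_iff u_nth)
  qed
qed

section \<open>Predefined-time formation\<close>

theorem corollary1:
  fixes zstar :: "real^'n" and dd :: "'n \<Rightarrow> 'n \<Rightarrow> real"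
    and \<Omega> \<Omega>h :: "real \<Rightarrow> real" and \<beta> :: "nat \<Rightarrow> real" and d Tc t0 :: real
  assumes "CARD('n) \<ge> 2"
    and "satisfies_displacement dd zstar"
    and "predefined_time_consensus_function \<Omega> \<Omega>h \<beta> d"
    and "\<Omega> 0 = 0"
    and "Tc > 0"
  shows "(\<forall>(F :: nat \<Rightarrow> 'n wgraph) r \<sigma> lam mmin mmax \<kappa>.
            switched_network t0 r F \<sigma> \<and> (\<forall>l\<in>{1..r}. connected_graph (F l)) \<and>
            lam = (MIN l\<in>{1..r}. lambda2 (laplacian (F l))) \<and>
            mmin = (MIN l\<in>{1..r}. card (edges (F l))) \<and>
            mmax = (MAX l\<in>{1..r}. card (edges (F l))) \<and>
            \<kappa> \<ge> \<beta> mmin powr d / (lam * (\<beta> mmax)\<^sup>2 * Tc) \<longrightarrow>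
            solves_formation_problem t0 Tc dd (edge_rule \<kappa> \<Omega> (\<lambda>t. F (\<sigma> t)) dd)) \<and>
         (\<forall>(X :: 'n wgraph) \<kappa>.
            weighted_graph X \<and> connected_graph X \<and>
            \<kappa> \<ge> 1 / (lambda2 (laplacian X) * \<beta> CARD('n) powr (2 - d) * Tc) \<longrightarrow>
            solves_formation_problem t0 Tc dd (node_rule \<kappa> \<Omega> X dd))"
proof (intro conjI allI impI; elim conjE)
  fix F :: "nat \<Rightarrow> 'n wgraph" and r \<sigma> lam mmin mmax \<kappa>
  assume net: "switched_network t0 r F \<sigma>" and conn: "\<forall>l\<in>{1..r}. connected_graph (F l)"
    and lam: "lam = (MIN l\<in>{1..r}. lambda2 (laplacian (F l)))"
    and mmin: "mmin = (MIN l\<in>{1..r}. card (edges (F l)))"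
    and mmax: "mmax = (MAX l\<in>{1..r}. card (edges (F l)))"
    and \<kappa>: "\<kappa> \<ge> \<beta> mmin powr d / (lam * (\<beta> mmax)\<^sup>2 * Tc)"
  have graph: "weighted_graph (F l)" if "l \<in> {1..r}" for l
    using net[unfolded switched_network_def, THEN conjunct1] that by (rule bspec)
  have active: "\<sigma> t \<in> {1..r}" if "t \<ge> t0" for t
    using net[unfolded switched_network_def switching_signal_def, THEN conjunct2, THEN conjunct1]
      that by simp
  have ne: "{1..r} \<noteq> {}" using active[of t0] by auto
  have "0 < lambda2 (laplacian (F l))" if "l \<in> {1..r}" for l
    by (rule lambda2_laplacian_pos[OF graph[OF that] bspec[OF conn that] assms(1)])
  then have "lam > 0" unfolding lam using ne by (subst Min_gr_iff) auto
  have "1 \<le> card (edges (F l))" if "l \<in> {1..r}" for l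
    by (rule connected_graph_card_edges[OF bspec[OF conn that] assms(1)])
  then have "mmin \<ge> 1" unfolding mmin using ne by (subst Min_ge_iff) auto
  define c where "c = \<beta> mmax * sqrt lam"
  have decay:
    "(c *\<^sub>R deviation (z - zstar)) \<bullet> (c *\<^sub>R deviation (edge_rule \<kappa> \<Omega> (\<lambda>t. F (\<sigma> t)) dd t z))
      \<le> - (1 / Tc) * \<Omega>h (norm (c *\<^sub>R deviation (z - zstar)))"
    "c *\<^sub>R deviation (z - zstar) = 0 \<Longrightarrow> edge_rule \<kappa> \<Omega> (\<lambda>t. F (\<sigma> t)) dd t z = 0"
    "c *\<^sub>R deviation (z - zstar) = 0 \<Longrightarrow> (z - zstar) $ i = (z - zstar) $ j"
    if "t \<ge> t0" for t z i j
  proof -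
    have rule: "edge_rule \<kappa> \<Omega> (\<lambda>t. F (\<sigma> t)) dd t z = edge_rule \<kappa> \<Omega> (\<lambda>_. F (\<sigma> t)) dd t z"
      by (simp add: edge_rule_def)
    have l: "\<sigma> t \<in> {1..r}" by (rule active[OF that])
    have "lam \<le> lambda2 (laplacian (F (\<sigma> t)))" "mmin \<le> card (edges (F (\<sigma> t)))"
        "card (edges (F (\<sigma> t))) \<le> mmax"
      unfolding lam mmin mmax using l by (auto intro!: Min_le Max_ge)
    note step = edge_rule_decay[OF assms(3,4,2,5) graph[OF l] bspec[OF conn l] assms(1) \<open>lam > 0\<close>
        this(1) \<open>mmin \<ge> 1\<close> this(2,3) \<kappa> c_def rule]
    show "(c *\<^sub>R deviation (z - zstar)) \<bullet> (c *\<^sub>R deviation (edge_rule \<kappa> \<Omega> (\<lambda>t. F (\<sigma> t)) dd t z))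
      \<le> - (1 / Tc) * \<Omega>h (norm (c *\<^sub>R deviation (z - zstar)))"
      by (rule step(1))
    show "c *\<^sub>R deviation (z - zstar) = 0 \<Longrightarrow> edge_rule \<kappa> \<Omega> (\<lambda>t. F (\<sigma> t)) dd t z = 0"
      by (rule step(2))
    show "c *\<^sub>R deviation (z - zstar) = 0 \<Longrightarrow> (z - zstar) $ i = (z - zstar) $ j"
      by (rule step(3))
  qed
  have lin: "linear (\<lambda>x. c *\<^sub>R deviation x :: real^'n)"
    by (rule linear_compose_scale_right[OF linear_deviation])
  show "solves_formation_problem t0 Tc dd (edge_rule \<kappa> \<Omega> (\<lambda>t. F (\<sigma> t)) dd)"
    unfolding solves_formation_problem_def
  proof (intro allI impI)
    fix z
    assume traj: "trajectory t0 (edge_rule \<kappa> \<Omega> (\<lambda>t. F (\<sigma> t)) dd) z"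
    note settled = predefined_time_settling[OF assms(3) traj lin assms(5) decay(2,1)]
    have "satisfies_displacement dd (z (t0 + Tc))"
      by (intro satisfies_displacement_shift[OF assms(2)] decay(3)[OF order_refl settled(1)])
    then show "\<exists>zbar. satisfies_displacement dd zbar \<and>
        (\<exists>T. 0 \<le> T \<and> T \<le> Tc \<and> (\<forall>t\<ge>t0 + T. z t = zbar))"
    proof (intro exI[of _ "z (t0 + Tc)"] conjI exI[of _ Tc] allI impI)
      show "z t = z (t0 + Tc)" if "t0 + Tc \<le> t" for t
        by (rule settled(2)) (use that in simp_all)
    qed (use assms(5) in simp_all)
  qed
next
  fix X :: "'n wgraph" and \<kappa>
  assume X: "weighted_graph X" "connected_graph X"
    and \<kappa>: "\<kappa> \<ge> 1 / (lambda2 (laplacian X) * \<beta> CARD('n) powr (2 - d) * Tc)"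
  define c where "c = \<beta> CARD('n) * sqrt (lambda2 (laplacian X))"
  note decay = node_rule_decay[OF assms(3,4,2,5) X assms(1) \<kappa> c_def refl]
  have lin: "linear (\<lambda>x. c *\<^sub>R incidence_map X x)"
    by (rule linear_compose_scale_right[OF linear_incidence_map])
  show "solves_formation_problem t0 Tc dd (node_rule \<kappa> \<Omega> X dd)"
    unfolding solves_formation_problem_def
  proof (intro allI impI)
    fix z
    assume traj: "trajectory t0 (node_rule \<kappa> \<Omega> X dd) z"
    note settled = predefined_time_settling[OF assms(3) traj lin assms(5) decay(2,1)]
    have "satisfies_displacement dd (z (t0 + Tc))"
      by (intro satisfies_displacement_shift[OF assms(2)] decay(3)[OF settled(1)])
    then show "\<exists>zbar. satisfies_displacement dd zbar \<and>
        (\<exists>T. 0 \<le> T \<and> T \<le> Tc \<and> (\<forall>t\<ge>t0 + T. z t = zbar))"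
    proof (intro exI[of _ "z (t0 + Tc)"] conjI exI[of _ Tc] allI impI)
      show "z t = z (t0 + Tc)" if "t0 + Tc \<le> t" for t
        by (rule settled(2)) (use that in simp_all)
    qed (use assms(5) in simp_all)
  qed
qed
end
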